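(* Let $\mathbb X$ be a virtual equipment and let $j\colon A\to E$ be a tight-cell. If $\ell\colon A\to C$ is a left $j$-adjoint (i.e. there is a relative adjunction $\ell\dashv_j r$ for some tight-cell $r\colon C\to E$), then $\ell$ preserves every (weighted) colimit that $j$ preserves.
   Context: Virtual equipments. A virtual double category has objects; a category of tight-cells $f\colon A\to B$ (the composite of $f\colon A\to B$ and $g\colon B\to C$ is $gf$); loose-cells $p\colon A\nrightarrow B$; and 2-cells, each having as frame a chain of loose-cells $p_1\colon A_1\nrightarrow A_0,\dots,p_n\colon A_n\nrightarrow A_{n-1}$ ($n\ge 0$; chains are always listed in this order), a loose-cell $q\colon B_n\nrightarrow B_0$, and tight-cells $f_0\colon A_0\to B_0$ (left) and $f_n\colon A_n\to B_n$ (right); 2-cells have identities and associative unital multicategory-style composition. $\phi\colon p_1,\dots,p_n\Rightarrow q$ denotes a 2-cell whose tight-cells are identities; $(\phi_1,\dots,\phi_n)$ denotes juxtaposition. A 2-cell $q_1,\dots,q_m\Rightarrow q$ is opcartesian if every 2-cell (with any tight-cells) with domain $p_1,\dots,p_l,q_1,\dots,q_m,r_1,\dots,r_n$ factors uniquely through it; then $q$ is the loose-composite $q_1\odot\cdots\odot q_m$ (the loose-identity $A(1,1)\colon A\nrightarrow A$ if $m=0$). A unary 2-cell from $p$ to $q$ with left $f$ and right $g$ is cartesian if every 2-cell into $q$ with left $ff'$ and right $gg'$ factors uniquely through it via a 2-cell with left $f'$ and right $g'$; then $p$ is the restriction $q(f,g)$. A virtual equipment has all loose-identities and restrictions. Write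 $E(f,g):=E(1,1)(f,g)$; for $f\colon D\to E$, $g\colon A\to E$ it is a loose-cell $A\nrightarrow D$. The canonical isomorphisms $q(f,g)\cong C(f,1)\odot q\odot B(1,g)$ are used implicitly. For $f\colon A\to B$, $\frown_f\colon ()\Rightarrow B(f,f)$ (corresponding to the identity of $f$) and $\smile_f\colon B(1,f),B(f,1)\Rightarrow B(1,1)$ are the canonical 2-cells. $\phi(f,g)$ denotes the 2-cell obtained from $\phi$ by restricting along $f$ on the left and $g$ on the right; e.g. $\smile_c(x,y)\colon E(x,c),E(c,y)\Rightarrow E(x,y)$ is composition and $\frown_g(x,y)\colon X(x,y)\Rightarrow X'(gx,gy)$ is the action of $g\colon X\to X'$. Relative adjunction. $\ell\dashv_j r$ consists of tight-cells $j\colon A\to E$, $\ell\colon A\to C$, $r\colon C\to E$ and an isomorphism $C(\ell,1)\cong E(j,r)$ of loose-cells $C\nrightarrow A$. Weighted colimits. A right lift of $q\colon X\nrightarrow Z$ through $p\colon Y\nrightarrow Z$ is a loose-cell $s\colon X\nrightarrow Y$ with a 2-cell $\varpi\colon p,s\Rightarrow q$ such that every 2-cell $p,r_1,\dots,r_n\Rightarrow q$ ($n\ge0$) factors uniquely as $\varpi\circ(1_p,\psi)$ with $\psi\colon r_1,\dots,r_n\Rightarrow s$. For a loose-cell $p\colon Y\nrightarrow Z$ and a tight-cell $f\colon Z\to X$, a $p$-cocone for $f$ is a pair of a tight-cell $c\colon Y\to X$ and a 2-cell $\lambda\colon p\Rightarrow X(f,c)$. It is colimiting (is the $p$-colimit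 of $f$) when the 2-cell $p,X(c,1)\Rightarrow X(f,1)$ given by $(\lambda,1)$ followed by $\smile_c(f,1)$ exhibits $X(c,1)$ as the right lift of $X(f,1)$ through $p$. A tight-cell $g\colon X\to X'$ preserves the $p$-colimit $(c,\lambda)$ of $f$ when the $p$-cocone $(gc,\ \frown_g(f,c)\circ\lambda\colon p\Rightarrow X'(gf,gc))$ is the $p$-colimit of $gf$. *)

theory Defs
  imports Main
begin

text \<open>
  Diagrams are drawn with loose-cells pointing to the left: the \<^emph>\<open>left\<close> boundary of a 2-cell
  sits at the targets of its loose-cells. A chain \<open>p\<^sub>1, \<dots>, p\<^sub>n\<close> of
  loose-cells \<open>p\<^sub>i : A\<^sub>i \<rightarrow> A\<^sub>i\<^sub>-\<^sub>1\<close> is the list \<open>[p\<^sub>1, \<dots>, p\<^sub>n]\<close>.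

  \<open>ccomp X \<chi> h [\<phi>\<^sub>1, \<dots>, \<phi>\<^sub>m]\<close> is the composite of \<open>\<chi>\<close> with a horizontally composable sequence
  of 2-cells whose leftmost tight-cell is \<open>h\<close>. For \<open>m > 0\<close> the argument \<open>h\<close> is redundant. For
  \<open>m = 0\<close> such a sequence is just the tight-cell \<open>h\<close>, and the composite is the nullary 2-cell
  \<open>\<chi>\<close> precomposed with \<open>h\<close>.
\<close>

record ('o, 't, 'l, 'c) vdc =
  Obj :: "'o set"
  Tight :: "'t set"
  tdom :: "'t \<Rightarrow> 'o"
  tcod :: "'t \<Rightarrow> 'o"
  tid :: "'o \<Rightarrow> 't"
  tcomp :: "'t \<Rightarrow> 't \<Rightarrow> 't" (infixr "\<cdot>\<index>" 70)
  Loose :: "'l set"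
  lsrc :: "'l \<Rightarrow> 'o"
  ltgt :: "'l \<Rightarrow> 'o"
  Cell :: "'c set"
  cdom :: "'c \<Rightarrow> 'l list"
  ccod :: "'c \<Rightarrow> 'l"
  cleft :: "'c \<Rightarrow> 't"
  cright :: "'c \<Rightarrow> 't"
  cid :: "'l \<Rightarrow> 'c"
  ccomp :: "'c \<Rightarrow> 't \<Rightarrow> 'c list \<Rightarrow> 'c"

context
  fixes X :: "('o, 't, 'l, 'c) vdc" (structure)
begin

definition tight_hom :: "'o \<Rightarrow> 'o \<Rightarrow> 't set" where
  "tight_hom A B = {f \<in> Tight X. tdom X f = A \<and> tcod X f = B}"

definition loose_hom :: "'o \<Rightarrow> 'o \<Rightarrow> 'l set" where
  "loose_hom A B = {p \<in> Loose X. lsrc X p = A \<and> ltgt X p = B}"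

text \<open>\<open>chain B ps A\<close>: the loose-cells \<open>ps\<close> are composable, with left end \<open>B\<close> and right end \<open>A\<close>.\<close>

fun chain :: "'o \<Rightarrow> 'l list \<Rightarrow> 'o \<Rightarrow> bool" where
  "chain B [] A \<longleftrightarrow> B \<in> Obj X \<and> A = B"
| "chain B (p # ps) A \<longleftrightarrow> p \<in> Loose X \<and> ltgt X p = B \<and> chain (lsrc X p) ps A"

text \<open>\<open>cpath h \<phi>s\<close>: the 2-cells \<open>\<phi>s\<close> are horizontally composable, with leftmost tight-cell \<open>h\<close>;
  \<open>cpath_right h \<phi>s\<close> is then the rightmost tight-cell.\<close>

fun cpath :: "'t \<Rightarrow> 'c list \<Rightarrow> bool" where
  "cpath h [] \<longleftrightarrow> h \<in> Tight X"
| "cpath h (\<phi> # \<phi>s) \<longleftrightarrow> \<phi> \<in> Cell X \<and> cleft X \<phi> = h \<and> cpath (cright X \<phi>) \<phi>s"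

fun cpath_right :: "'t \<Rightarrow> 'c list \<Rightarrow> 't" where
  "cpath_right h [] = h"
| "cpath_right h (\<phi> # \<phi>s) = cpath_right (cright X \<phi>) \<phi>s"

definition composable :: "'c \<Rightarrow> 't \<Rightarrow> 'c list \<Rightarrow> bool" where
  "composable \<chi> h \<phi>s \<longleftrightarrow>
     \<chi> \<in> Cell X \<and> cpath h \<phi>s \<and> map (ccod X) \<phi>s = cdom X \<chi> \<and> tcod X h = tdom X (cleft X \<chi>)"

text \<open>Composes each \<open>\<phi>\<^sub>i\<close> with the block \<open>\<psi>s\<^sub>i\<close> of a sequence of 2-cells with leftmost
  tight-cell \<open>m\<close>; the leftmost tight-cell of every block is the rightmost one of the
  preceding block, which matters when the block is empty.\<close>

fun ccomps :: "'t \<Rightarrow> 'c list \<Rightarrow> 'c list list \<Rightarrow> 'c list" where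
  "ccomps m (\<phi> # \<phi>s) (\<psi>s # \<psi>ss) = ccomp X \<phi> m \<psi>s # ccomps (cpath_right m \<psi>s) \<phi>s \<psi>ss"
| "ccomps m _ _ = []"

definition cells :: "'t \<Rightarrow> 'l list \<Rightarrow> 'l \<Rightarrow> 't \<Rightarrow> 'c set" where
  "cells f ps q g =
     {\<phi> \<in> Cell X. cleft X \<phi> = f \<and> cdom X \<phi> = ps \<and> ccod X \<phi> = q \<and> cright X \<phi> = g}"

text \<open>The 2-cells \<open>ps \<Rightarrow> q\<close> whose tight-cells are identities.\<close>

definition gcells :: "'l list \<Rightarrow> 'l \<Rightarrow> 'c set" where
  "gcells ps q = cells (tid X (ltgt X q)) ps q (tid X (lsrc X q))"

definition loose_iso :: "'c \<Rightarrow> 'l \<Rightarrow> 'l \<Rightarrow> bool" where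
  "loose_iso \<phi> p q \<longleftrightarrow> \<phi> \<in> gcells [p] q \<and>
     (\<exists>\<psi> \<in> gcells [q] p. ccomp X \<psi> (tid X (ltgt X p)) [\<phi>] = cid X p \<and>
                        ccomp X \<phi> (tid X (ltgt X q)) [\<psi>] = cid X q)"

end

locale virtual_double_category =
  fixes X :: "('o, 't, 'l, 'c) vdc" (structure)
  assumes tight_dom: "f \<in> Tight X \<Longrightarrow> tdom X f \<in> Obj X"
    and tight_cod: "f \<in> Tight X \<Longrightarrow> tcod X f \<in> Obj X"
    and tid_hom: "A \<in> Obj X \<Longrightarrow> tid X A \<in> tight_hom X A A"
    and tcomp_hom: "f \<in> tight_hom X A B \<Longrightarrow> g \<in> tight_hom X B C \<Longrightarrow> g \<cdot> f \<in> tight_hom X A C"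
    and tcomp_tid_right: "f \<in> tight_hom X A B \<Longrightarrow> f \<cdot> tid X A = f"
    and tcomp_tid_left: "f \<in> tight_hom X A B \<Longrightarrow> tid X B \<cdot> f = f"
    and tcomp_assoc: "f \<in> tight_hom X A B \<Longrightarrow> g \<in> tight_hom X B C \<Longrightarrow> h \<in> tight_hom X C D
      \<Longrightarrow> (h \<cdot> g) \<cdot> f = h \<cdot> (g \<cdot> f)"
    and loose_src: "p \<in> Loose X \<Longrightarrow> lsrc X p \<in> Obj X"
    and loose_tgt: "p \<in> Loose X \<Longrightarrow> ltgt X p \<in> Obj X"
    and cell_left: "\<phi> \<in> Cell X \<Longrightarrow> cleft X \<phi> \<in> Tight X"
    and cell_right: "\<phi> \<in> Cell X \<Longrightarrow> cright X \<phi> \<in> Tight X"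
    and cell_dom: "\<phi> \<in> Cell X \<Longrightarrow> chain X (tdom X (cleft X \<phi>)) (cdom X \<phi>) (tdom X (cright X \<phi>))"
    and cell_cod: "\<phi> \<in> Cell X \<Longrightarrow> ccod X \<phi> \<in> loose_hom X (tcod X (cright X \<phi>)) (tcod X (cleft X \<phi>))"
    and cid_cell: "p \<in> Loose X \<Longrightarrow> cid X p \<in> gcells X [p] p"
    and ccomp_cell: "composable X \<chi> h \<phi>s \<Longrightarrow>
      ccomp X \<chi> h \<phi>s \<in> cells X (cleft X \<chi> \<cdot> h) (concat (map (cdom X) \<phi>s)) (ccod X \<chi>)
                         (cright X \<chi> \<cdot> cpath_right X h \<phi>s)"
    and ccomp_cid_right: "\<chi> \<in> Cell X \<Longrightarrow>
      ccomp X \<chi> (tid X (tdom X (cleft X \<chi>))) (map (cid X) (cdom X \<chi>)) = \<chi>"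
    and ccomp_cid_left: "\<chi> \<in> Cell X \<Longrightarrow> ccomp X (cid X (ccod X \<chi>)) (cleft X \<chi>) [\<chi>] = \<chi>"
    and ccomp_assoc: "composable X \<chi> h \<phi>s \<Longrightarrow> cpath X m (concat \<psi>ss) \<Longrightarrow>
      map (map (ccod X)) \<psi>ss = map (cdom X) \<phi>s \<Longrightarrow> tcod X m = tdom X h \<Longrightarrow>
      ccomp X (ccomp X \<chi> h \<phi>s) m (concat \<psi>ss) = ccomp X \<chi> (h \<cdot> m) (ccomps X m \<phi>s \<psi>ss)"

context
  fixes X :: "('o, 't, 'l, 'c) vdc" (structure)
begin

text \<open>The condition that \<open>ps @ [ccod X \<theta>] @ rs\<close> be a chain is automatic unless \<open>\<theta>\<close> is nullary,
  in which case it says that \<open>\<theta>\<close> is inserted at the right object.\<close>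

definition opcartesian :: "'c \<Rightarrow> bool" where
  "opcartesian \<theta> \<longleftrightarrow> \<theta> \<in> gcells X (cdom X \<theta>) (ccod X \<theta>) \<and>
     (\<forall>f ps rs s g. \<forall>\<chi> \<in> cells X f (ps @ cdom X \<theta> @ rs) s g.
        chain X (tdom X f) (ps @ [ccod X \<theta>] @ rs) (tdom X g) \<longrightarrow>
        (\<exists>!\<psi>. \<psi> \<in> cells X f (ps @ [ccod X \<theta>] @ rs) s g \<and>
          ccomp X \<psi> (tid X (tdom X f)) (map (cid X) ps @ [\<theta>] @ map (cid X) rs) = \<chi>))"

definition cartesian :: "'c \<Rightarrow> bool" where
  "cartesian \<kappa> \<longleftrightarrow> \<kappa> \<in> Cell X \<and> (\<exists>p. cdom X \<kappa> = [p] \<and>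
     (\<forall>f' g' ps. f' \<in> Tight X \<longrightarrow> tcod X f' = tdom X (cleft X \<kappa>) \<longrightarrow>
        g' \<in> Tight X \<longrightarrow> tcod X g' = tdom X (cright X \<kappa>) \<longrightarrow>
        (\<forall>\<chi> \<in> cells X (cleft X \<kappa> \<cdot> f') ps (ccod X \<kappa>) (cright X \<kappa> \<cdot> g').
          \<exists>!\<psi>. \<psi> \<in> cells X f' ps p g' \<and> ccomp X \<kappa> f' [\<psi>] = \<chi>)))"

definition opcart_factor :: "'c \<Rightarrow> 'l list \<Rightarrow> 'l list \<Rightarrow> 'c \<Rightarrow> 'c" where
  "opcart_factor \<theta> ps rs \<chi> =
     (THE \<psi>. \<psi> \<in> cells X (cleft X \<chi>) (ps @ [ccod X \<theta>] @ rs) (ccod X \<chi>) (cright X \<chi>) \<and>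
        ccomp X \<psi> (tid X (tdom X (cleft X \<chi>))) (map (cid X) ps @ [\<theta>] @ map (cid X) rs) = \<chi>)"

definition cart_factor :: "'c \<Rightarrow> 't \<Rightarrow> 't \<Rightarrow> 'c \<Rightarrow> 'c" where
  "cart_factor \<kappa> f' g' \<chi> =
     (THE \<psi>. \<psi> \<in> cells X f' (cdom X \<chi>) (hd (cdom X \<kappa>)) g' \<and> ccomp X \<kappa> f' [\<psi>] = \<chi>)"

definition is_lid_cell :: "'o \<Rightarrow> 'c \<Rightarrow> bool" where
  "is_lid_cell A u \<longleftrightarrow> opcartesian u \<and> cdom X u = [] \<and> ccod X u \<in> loose_hom X A A"

definition is_restr_cell :: "'l \<Rightarrow> 't \<Rightarrow> 't \<Rightarrow> 'c \<Rightarrow> bool" where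
  "is_restr_cell q f g \<kappa> \<longleftrightarrow>
     cartesian \<kappa> \<and> ccod X \<kappa> = q \<and> cleft X \<kappa> = f \<and> cright X \<kappa> = g"

end

locale virtual_equipment = virtual_double_category X
  for X :: "('o, 't, 'l, 'c) vdc" (structure) +
  assumes ex_lid: "A \<in> Obj X \<Longrightarrow> \<exists>u. is_lid_cell X A u"
    and ex_restr: "q \<in> Loose X \<Longrightarrow> f \<in> Tight X \<Longrightarrow> tcod X f = ltgt X q \<Longrightarrow>
      g \<in> Tight X \<Longrightarrow> tcod X g = lsrc X q \<Longrightarrow> \<exists>\<kappa>. is_restr_cell X q f g \<kappa>"

text \<open>
  Loose-identities and restrictions are determined up to unique isomorphism only; the
  notations \<open>A(1,1)\<close> and \<open>q(f,g)\<close> refer to an arbitrary choice of them.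
\<close>

context
  fixes X :: "('o, 't, 'l, 'c) vdc" (structure)
begin

definition lid_cell :: "'o \<Rightarrow> 'c" where
  "lid_cell A = (SOME u. is_lid_cell X A u)"

definition lid :: "'o \<Rightarrow> 'l" where
  "lid A = ccod X (lid_cell A)"

definition restr_cell :: "'l \<Rightarrow> 't \<Rightarrow> 't \<Rightarrow> 'c" where
  "restr_cell q f g = (SOME \<kappa>. is_restr_cell X q f g \<kappa>)"

definition restr :: "'l \<Rightarrow> 't \<Rightarrow> 't \<Rightarrow> 'l" where
  "restr q f g = hd (cdom X (restr_cell q f g))"

text \<open>\<open>hom f g\<close> is the loose-cell \<open>E(f,g)\<close>, where \<open>E\<close> is the common codomain of \<open>f\<close> and \<open>g\<close>.\<close>

definition hom :: "'t \<Rightarrow> 't \<Rightarrow> 'l" where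
  "hom f g = restr (lid (tcod X f)) f g"

definition hom_cell :: "'t \<Rightarrow> 't \<Rightarrow> 'c" where
  "hom_cell f g = restr_cell (lid (tcod X f)) f g"

text \<open>The cartesian 2-cell \<open>E(fx,gy) \<Rightarrow> E(f,g)\<close> with left \<open>x\<close> and right \<open>y\<close> that identifies
  \<open>E(fx,gy)\<close> with the restriction \<open>E(f,g)(x,y)\<close>.\<close>

definition hom_restr_cell :: "'t \<Rightarrow> 't \<Rightarrow> 't \<Rightarrow> 't \<Rightarrow> 'c" where
  "hom_restr_cell f g x y = cart_factor X (hom_cell f g) x y (hom_cell (f \<cdot> x) (g \<cdot> y))"

text \<open>The canonical 2-cell \<open>A(1,1), A(1,1) \<Rightarrow> A(1,1)\<close>: the factorisation of the identity of
  \<open>A(1,1)\<close> through the opcartesian \<open>() \<Rightarrow> A(1,1)\<close> in second position.\<close>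

definition lid_mult :: "'o \<Rightarrow> 'c" where
  "lid_mult A = opcart_factor X (lid_cell A) [lid A] [] (cid X (lid A))"

text \<open>\<open>cap f\<close> is \<open>\<frown>\<^sub>f : () \<Rightarrow> B(f,f)\<close>. The 2-cell \<open>() \<Rightarrow> B(1,1)\<close> with left and right \<open>f\<close>
  obtained by precomposing with \<open>f\<close> is the identity of \<open>f\<close>.\<close>

definition cap :: "'t \<Rightarrow> 'c" where
  "cap f = cart_factor X (hom_cell f f) (tid X (tdom X f)) (tid X (tdom X f))
             (ccomp X (lid_cell (tcod X f)) f [])"

text \<open>\<open>cup f\<close> is \<open>\<smile>\<^sub>f : B(1,f), B(f,1) \<Rightarrow> B(1,1)\<close>.\<close>

definition cup :: "'t \<Rightarrow> 'c" where
  "cup f = (let i = tid X (tcod X f) in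
     ccomp X (lid_mult (tcod X f)) i [hom_cell i f, hom_cell f i])"

text \<open>\<open>cap_restr g x y\<close> is \<open>\<frown>\<^sub>g(x,y) : X(x,y) \<Rightarrow> X'(gx,gy)\<close>. The nullary \<open>\<frown>\<^sub>g\<close> is restricted by
  first turning it into a 2-cell \<open>X(1,1) \<Rightarrow> X'(g,g)\<close>.\<close>

definition cap_restr :: "'t \<Rightarrow> 't \<Rightarrow> 't \<Rightarrow> 'c" where
  "cap_restr g x y =
     cart_factor X (hom_restr_cell g g x y) (tid X (tdom X x)) (tid X (tdom X y))
       (ccomp X (opcart_factor X (lid_cell (tdom X g)) [] [] (cap g)) x [hom_cell x y])"

text \<open>\<open>cup_restr c x y\<close> is \<open>\<smile>\<^sub>c(x,y) : E(x,c), E(c,y) \<Rightarrow> E(x,y)\<close>.\<close>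

definition cup_restr :: "'t \<Rightarrow> 't \<Rightarrow> 't \<Rightarrow> 'c" where
  "cup_restr c x y = (let i = tid X (tcod X c); k = tid X (tdom X c) in
     cart_factor X (hom_cell x y) (tid X (tdom X x)) (tid X (tdom X y))
       (ccomp X (cup c) x [hom_restr_cell i c x k, hom_restr_cell c i k y]))"

definition relative_adjunction :: "'t \<Rightarrow> 't \<Rightarrow> 't \<Rightarrow> 'c \<Rightarrow> bool" where
  "relative_adjunction j l r \<phi> \<longleftrightarrow>
     (\<exists>A C E. j \<in> tight_hom X A E \<and> l \<in> tight_hom X A C \<and> r \<in> tight_hom X C E \<and>
        loose_iso X \<phi> (hom l (tid X C)) (hom j r))"

definition left_relative_adjoint :: "'t \<Rightarrow> 't \<Rightarrow> bool" where
  "left_relative_adjoint j l \<longleftrightarrow> (\<exists>r \<phi>. relative_adjunction j l r \<phi>)"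

text \<open>\<open>right_lift p q s \<omega>\<close>: \<open>\<omega> : p, s \<Rightarrow> q\<close> exhibits \<open>s\<close> as the right lift of \<open>q\<close> through \<open>p\<close>.\<close>

definition right_lift :: "'l \<Rightarrow> 'l \<Rightarrow> 'l \<Rightarrow> 'c \<Rightarrow> bool" where
  "right_lift p q s \<omega> \<longleftrightarrow> \<omega> \<in> gcells X [p, s] q \<and>
     (\<forall>rs. \<forall>\<phi> \<in> gcells X (p # rs) q.
        \<exists>!\<psi>. \<psi> \<in> gcells X rs s \<and> ccomp X \<omega> (tid X (ltgt X p)) [cid X p, \<psi>] = \<phi>)"

definition cocone :: "'l \<Rightarrow> 't \<Rightarrow> 't \<Rightarrow> 'c \<Rightarrow> bool" where
  "cocone p f c lam \<longleftrightarrow>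
     (\<exists>Y Z A. p \<in> loose_hom X Y Z \<and> f \<in> tight_hom X Z A \<and> c \<in> tight_hom X Y A \<and>
        lam \<in> gcells X [p] (hom f c))"

text \<open>\<open>colimit p f c lam\<close>: \<open>(c, lam)\<close> is a \<open>p\<close>-colimit of \<open>f\<close>.\<close>

definition colimit :: "'l \<Rightarrow> 't \<Rightarrow> 't \<Rightarrow> 'c \<Rightarrow> bool" where
  "colimit p f c lam \<longleftrightarrow> cocone p f c lam \<and>
     (let i = tid X (tcod X f) in
       right_lift p (hom f i) (hom c i)
         (ccomp X (cup_restr c f i) (tid X (ltgt X p)) [lam, cid X (hom c i)]))"

definition preserves_colimit :: "'t \<Rightarrow> 'l \<Rightarrow> 't \<Rightarrow> 't \<Rightarrow> 'c \<Rightarrow> bool" where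
  "preserves_colimit g p f c lam \<longleftrightarrow>
     colimit p (g \<cdot> f) (g \<cdot> c) (ccomp X (cap_restr g f c) (tid X (ltgt X p)) [lam])"

end

end

theory Submission
  imports Defs
begin

text \<open>
  Since restrictions of loose-identities are cartesian, the colimit condition for a cocone
  \<open>lam : p \<Rightarrow> B(h,k)\<close> says that, for the corresponding 2-cell \<open>\<zeta> : p \<Rightarrow> B(1,1)\<close> with left \<open>h\<close> and right
  \<open>k\<close>, pasting with \<open>\<zeta>\<close> is a bijection from 2-cells into \<open>B(1,1)\<close> with left \<open>k\<close> and right \<open>1\<close> to 2-cells
  into \<open>B(1,1)\<close> with left \<open>h\<close> and right \<open>1\<close>. The companion of a tight-cell \<open>x\<close> extends this to 2-cells
  with right \<open>x\<close>. For \<open>\<zeta> : p \<Rightarrow> A(1,1)\<close> and a cartesian 2-cell \<open>q \<Rightarrow> B(1,1)\<close> with left \<open>g\<close> and right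
  \<open>x\<close>, the extended condition for the image of \<open>\<zeta>\<close> under \<open>g\<close> involves only \<open>\<zeta>\<close>, \<open>q\<close> and the
  canonical \<open>A(1,1), q \<Rightarrow> q\<close>, not \<open>g\<close>. An isomorphism \<open>C(l,1) \<cong> E(j,r)\<close> makes \<open>q = C(l,1)\<close> such a
  restriction both along \<open>l, 1\<close> and along \<open>j, r\<close>, so the condition passes from \<open>j\<close> to \<open>l\<close>.
\<close>

section \<open>Universal properties as bijections\<close>

text \<open>Universal properties are stated by unique existence but transported by composing
  bijections; this is the dictionary between the two forms.\<close>

lemma bij_betw_iff_ex1:
  assumes "\<And>x. x \<in> P \<Longrightarrow> F x \<in> Q"
  shows "bij_betw F P Q \<longleftrightarrow> (\<forall>y\<in>Q. \<exists>!x. x \<in> P \<and> F x = y)"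
proof
  assume *: "bij_betw F P Q"
  show "\<forall>y\<in>Q. \<exists>!x. x \<in> P \<and> F x = y"
    using bij_betw_imp_inj_on[OF *] bij_betw_imp_surj_on[OF *] by (auto dest: inj_onD)
next
  assume *: "\<forall>y\<in>Q. \<exists>!x. x \<in> P \<and> F x = y"
  show "bij_betw F P Q"
  proof (rule bij_betw_imageI)
    show "inj_on F P"
    proof (rule inj_onI)
      fix x y assume "x \<in> P" "y \<in> P" "F x = F y"
      with *[rule_format, OF assms[of y]] show "x = y" by auto
    qed
    show "F ` P = Q"
    proof
      show "F ` P \<subseteq> Q" using assms by auto
      show "Q \<subseteq> F ` P" using * by blast
    qed
  qed
qed

text \<open>The two ways around the square agree on \<open>P\<close>, and composing with the
  bijections \<open>a\<close> and \<open>b\<close> does not affect bijectivity. Both comparisons of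
  lifting conditions below have this shape.\<close>

lemma bij_betw_square:
  assumes "bij_betw a P P'" "bij_betw b Q Q'"
    and "\<And>x. x \<in> P \<Longrightarrow> F x \<in> Q" "\<And>x. x \<in> P \<Longrightarrow> b (F x) = G (a x)"
  shows "bij_betw F P Q \<longleftrightarrow> bij_betw G P' Q'"
proof -
  have "bij_betw F P Q \<longleftrightarrow> bij_betw (b \<circ> F) P Q'"
    using assms(3) by (intro bij_betw_comp_iff2[OF assms(2)]) auto
  also have "\<dots> \<longleftrightarrow> bij_betw (G \<circ> a) P Q'"
    using assms(4) by (intro bij_betw_cong) simp
  also have "\<dots> \<longleftrightarrow> bij_betw G P' Q'"
    by (rule bij_betw_comp_iff[OF assms(1), symmetric])
  finally show ?thesis .
qed

subsection \<open>Virtual double categories\<close>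

context virtual_double_category
begin

lemma tight_homD:
  assumes "f \<in> tight_hom X A B"
  shows "f \<in> Tight X" "tdom X f = A" "tcod X f = B" "A \<in> Obj X" "B \<in> Obj X"
  using assms tight_dom tight_cod by (auto simp: tight_hom_def)

lemma tight_homI: "f \<in> Tight X \<Longrightarrow> tdom X f = A \<Longrightarrow> tcod X f = B \<Longrightarrow> f \<in> tight_hom X A B"
  by (simp add: tight_hom_def)

lemma tid_simps [simp]:
  assumes "A \<in> Obj X"
  shows "tid X A \<in> Tight X" "tdom X (tid X A) = A" "tcod X (tid X A) = A"
  using tight_homD[OF tid_hom[OF assms]] by auto

lemma tcomp_simps [simp]:
  assumes "f \<in> Tight X" "g \<in> Tight X" "tcod X f = tdom X g"
  shows "g \<cdot> f \<in> Tight X" "tdom X (g \<cdot> f) = tdom X f" "tcod X (g \<cdot> f) = tcod X g"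
  using tight_homD[OF tcomp_hom[of f "tdom X f" "tcod X f" g "tcod X g"]] assms
  by (auto simp: tight_hom_def)

lemma tcomp_tid [simp]:
  assumes "f \<in> Tight X"
  shows "tdom X f = A \<Longrightarrow> f \<cdot> tid X A = f" "tcod X f = B \<Longrightarrow> tid X B \<cdot> f = f"
  using assms tcomp_tid_left tcomp_tid_right by (auto simp: tight_hom_def)

lemma cellsD:
  assumes "\<phi> \<in> cells X f ps q g"
  shows "\<phi> \<in> Cell X" "cleft X \<phi> = f" "cdom X \<phi> = ps" "ccod X \<phi> = q" "cright X \<phi> = g"
    "f \<in> Tight X" "g \<in> Tight X" "chain X (tdom X f) ps (tdom X g)"
    "q \<in> Loose X" "lsrc X q = tcod X g" "ltgt X q = tcod X f"
  using assms cell_left[of \<phi>] cell_right[of \<phi>] cell_dom[of \<phi>] cell_cod[of \<phi>]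
  by (auto simp: cells_def loose_hom_def)

lemma cid_cells: "p \<in> Loose X \<Longrightarrow> cid X p \<in> cells X (tid X (ltgt X p)) [p] p (tid X (lsrc X p))"
  using cid_cell by (simp add: gcells_def)

section \<open>Composability and associativity for short rows of 2-cells\<close>

lemma composable0:
  assumes "\<alpha> \<in> cells X f [] s g" "h \<in> Tight X" "tcod X h = tdom X f"
  shows "composable X \<alpha> h []"
  using assms by (simp add: composable_def cells_def)

lemma composable1:
  assumes "\<alpha> \<in> cells X f [q] s g" "\<phi> \<in> cells X h ps q k"
  shows "composable X \<alpha> h [\<phi>]"
  using assms cellsD[OF assms(1)] cellsD[OF assms(2)] by (auto simp: composable_def)

lemma composable2:
  assumes "\<alpha> \<in> cells X f [q1, q2] s g" "\<phi> \<in> cells X h ps q1 m" "\<psi> \<in> cells X m rs q2 k"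
  shows "composable X \<alpha> h [\<phi>, \<psi>]"
  using assms cellsD[OF assms(1)] cellsD[OF assms(2)] cellsD[OF assms(3)]
  by (auto simp: composable_def)

lemma ccomp0:
  assumes "\<alpha> \<in> cells X f [] s g" "h \<in> Tight X" "tcod X h = tdom X f"
  shows "ccomp X \<alpha> h [] \<in> cells X (f \<cdot> h) [] s (g \<cdot> h)"
  using ccomp_cell[OF composable0[OF assms]] cellsD[OF assms(1)] by simp

lemma ccomp1:
  assumes "\<alpha> \<in> cells X f [q] s g" "\<phi> \<in> cells X h ps q k"
  shows "ccomp X \<alpha> h [\<phi>] \<in> cells X (f \<cdot> h) ps s (g \<cdot> k)"
  using ccomp_cell[OF composable1[OF assms]] cellsD[OF assms(1)] cellsD[OF assms(2)] by simp

lemma ccomp2: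
  assumes "\<alpha> \<in> cells X f [q1, q2] s g" "\<phi> \<in> cells X h ps q1 m" "\<psi> \<in> cells X m rs q2 k"
  shows "ccomp X \<alpha> h [\<phi>, \<psi>] \<in> cells X (f \<cdot> h) (ps @ rs) s (g \<cdot> k)"
  using ccomp_cell[OF composable2[OF assms]] cellsD[OF assms(1)] cellsD[OF assms(2)]
    cellsD[OF assms(3)] by simp

lemma ccomp_assoc1:
  assumes "composable X \<alpha> h [\<beta>]" "composable X \<beta> m \<gamma>s"
  shows "ccomp X (ccomp X \<alpha> h [\<beta>]) m \<gamma>s = ccomp X \<alpha> (h \<cdot> m) [ccomp X \<beta> m \<gamma>s]"
  using ccomp_assoc[OF assms(1), of m "[\<gamma>s]"] assms by (simp add: composable_def)

lemma cpath_append: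
  "cpath X h (\<phi>s @ \<psi>s) \<longleftrightarrow> cpath X h \<phi>s \<and> cpath X (cpath_right X h \<phi>s) \<psi>s"
proof (induction \<phi>s arbitrary: h)
  case Nil
  \<comment> \<open>The empty path still demands that \<open>h\<close> be tight; before a non-empty
    path this follows from the left tight-cell of its first 2-cell.\<close>
  show ?case by (cases \<psi>s) (auto dest: cell_left)
qed auto

lemma cpath_right_append: "cpath_right X h (\<phi>s @ \<psi>s) = cpath_right X (cpath_right X h \<phi>s) \<psi>s"
  by (induction \<phi>s arbitrary: h) auto

text \<open>The second block starts at the rightmost tight-cell of the first, so either block may be
  empty. This is how nullary units get inserted later.\<close>

lemma ccomp_assoc2:
  assumes "composable X \<alpha> h [\<beta>, \<beta>']" "composable X \<beta> m \<gamma>s"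
    and "composable X \<beta>' (cpath_right X m \<gamma>s) \<gamma>s'"
  shows "ccomp X (ccomp X \<alpha> h [\<beta>, \<beta>']) m (\<gamma>s @ \<gamma>s') =
    ccomp X \<alpha> (h \<cdot> m) [ccomp X \<beta> m \<gamma>s, ccomp X \<beta>' (cpath_right X m \<gamma>s) \<gamma>s']"
  using ccomp_assoc[OF assms(1), of m "[\<gamma>s, \<gamma>s']"] assms
  by (simp add: composable_def cpath_append)

section \<open>Rows of identities on a chain, and insertion of a 2-cell into them\<close>

lemma chain_Obj: "chain X B ps A \<Longrightarrow> B \<in> Obj X \<and> A \<in> Obj X"
  by (induction ps arbitrary: B) (auto dest: loose_tgt)

lemma chain_append: "chain X B (ps @ rs) A \<longleftrightarrow> (\<exists>M. chain X B ps M \<and> chain X M rs A)"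
proof (induction ps arbitrary: B)
  case Nil
  show ?case by (auto dest: chain_Obj)
qed auto

lemma chain_cids:
  assumes "chain X B ps A"
  shows "cpath X (tid X B) (map (cid X) ps)" "cpath_right X (tid X B) (map (cid X) ps) = tid X A"
    "concat (map (cdom X) (map (cid X) ps)) = ps" "map (ccod X) (map (cid X) ps) = ps"
proof -
  have "cpath X (tid X B) (map (cid X) ps) \<and> cpath_right X (tid X B) (map (cid X) ps) = tid X A
    \<and> concat (map (cdom X) (map (cid X) ps)) = ps \<and> map (ccod X) (map (cid X) ps) = ps"
    using assms
  proof (induction ps arbitrary: B)
    case (Cons p ps)
    then show ?case using cellsD[OF cid_cells[of p]] by auto
  qed auto
  then show "cpath X (tid X B) (map (cid X) ps)"
    "cpath_right X (tid X B) (map (cid X) ps) = tid X A"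
    "concat (map (cdom X) (map (cid X) ps)) = ps" "map (ccod X) (map (cid X) ps) = ps"
    by auto
qed

lemma composable_insert:
  assumes \<chi>: "\<chi> \<in> cells X f (ps @ [q] @ rs) s g"
    and \<theta>: "\<theta> \<in> gcells X qs q"
  shows "composable X \<chi> (tid X (tdom X f)) (map (cid X) ps @ [\<theta>] @ map (cid X) rs)"
    and "ccomp X \<chi> (tid X (tdom X f)) (map (cid X) ps @ [\<theta>] @ map (cid X) rs)
      \<in> cells X f (ps @ qs @ rs) s g"
proof -
  note c = cellsD[OF \<chi>]
  note t = cellsD[OF \<theta>[unfolded gcells_def]]
  have ch: "chain X (tdom X f) ps (ltgt X q)" "chain X (lsrc X q) rs (tdom X g)"
    using c(8) by (auto simp: chain_append)
  show C: "composable X \<chi> (tid X (tdom X f)) (map (cid X) ps @ [\<theta>] @ map (cid X) rs)"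
    using c t chain_cids[OF ch(1)] chain_cids[OF ch(2)] tight_dom[of f]
    by (simp add: composable_def cpath_append)
  show "ccomp X \<chi> (tid X (tdom X f)) (map (cid X) ps @ [\<theta>] @ map (cid X) rs)
      \<in> cells X f (ps @ qs @ rs) s g"
    using ccomp_cell[OF C] c t chain_cids[OF ch(1)] chain_cids[OF ch(2)]
    by (simp add: cpath_right_append)
qed

text \<open>At the right end of a chain nothing follows \<open>\<theta>\<close>, so its right
  tight-cell \<open>m\<close> may be arbitrary. The unit of a companion is inserted in this
  way.\<close>

lemma composable_insert_right:
  assumes \<chi>: "\<chi> \<in> cells X f (ps @ [q]) s g"
    and \<theta>: "\<theta> \<in> cells X (tid X (ltgt X q)) qs q m"
  shows "composable X \<chi> (tid X (tdom X f)) (map (cid X) ps @ [\<theta>])"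
    and "ccomp X \<chi> (tid X (tdom X f)) (map (cid X) ps @ [\<theta>]) \<in> cells X f (ps @ qs) s (g \<cdot> m)"
proof -
  note c = cellsD[OF \<chi>]
  note t = cellsD[OF \<theta>]
  have ch: "chain X (tdom X f) ps (ltgt X q)"
    using c(8) by (auto simp: chain_append)
  show C: "composable X \<chi> (tid X (tdom X f)) (map (cid X) ps @ [\<theta>])"
    using c t chain_cids[OF ch] tight_dom[of f]
    by (simp add: composable_def cpath_append)
  show "ccomp X \<chi> (tid X (tdom X f)) (map (cid X) ps @ [\<theta>]) \<in> cells X f (ps @ qs) s (g \<cdot> m)"
    using ccomp_cell[OF C] c t chain_cids[OF ch]
    by (simp add: cpath_right_append)
qed

section \<open>Opcartesian and cartesian 2-cells\<close>

lemma opcartesian_ex1: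
  assumes op: "opcartesian X \<theta>"
    and \<chi>: "\<chi> \<in> cells X f (ps @ cdom X \<theta> @ rs) s g"
    and ch: "chain X (tdom X f) (ps @ [ccod X \<theta>] @ rs) (tdom X g)"
  shows "\<exists>!\<psi>. \<psi> \<in> cells X f (ps @ [ccod X \<theta>] @ rs) s g \<and>
          ccomp X \<psi> (tid X (tdom X f)) (map (cid X) ps @ [\<theta>] @ map (cid X) rs) = \<chi>"
  using op \<chi> ch unfolding opcartesian_def by blast

lemma opcart_factorD:
  assumes op: "opcartesian X \<theta>"
    and \<chi>: "\<chi> \<in> cells X f (ps @ cdom X \<theta> @ rs) s g"
    and ch: "chain X (tdom X f) (ps @ [ccod X \<theta>] @ rs) (tdom X g)"
  shows "opcart_factor X \<theta> ps rs \<chi> \<in> cells X f (ps @ [ccod X \<theta>] @ rs) s g"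
    "ccomp X (opcart_factor X \<theta> ps rs \<chi>) (tid X (tdom X f))
       (map (cid X) ps @ [\<theta>] @ map (cid X) rs) = \<chi>"
  using theI'[OF opcartesian_ex1[OF assms]] cellsD[OF \<chi>] by (simp_all add: opcart_factor_def)

text \<open>Both 2-cells are factorisations of one composite through \<open>\<theta>\<close>, so
  uniqueness identifies them.\<close>

lemma opcartesian_eqI:
  assumes op: "opcartesian X \<theta>"
    and \<chi>: "\<chi> \<in> cells X f (ps @ [ccod X \<theta>] @ rs) s g" "\<chi>' \<in> cells X f (ps @ [ccod X \<theta>] @ rs) s g"
    and eq: "ccomp X \<chi> (tid X (tdom X f)) (map (cid X) ps @ [\<theta>] @ map (cid X) rs) =
      ccomp X \<chi>' (tid X (tdom X f)) (map (cid X) ps @ [\<theta>] @ map (cid X) rs)"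
  shows "\<chi> = \<chi>'"
proof -
  have g: "\<theta> \<in> gcells X (cdom X \<theta>) (ccod X \<theta>)"
    using op by (simp add: opcartesian_def)
  from opcartesian_ex1[OF op composable_insert(2)[OF \<chi>(1) g] cellsD(8)[OF \<chi>(1)]]
  obtain \<psi> where \<psi>: "\<And>\<psi>'. \<psi>' \<in> cells X f (ps @ [ccod X \<theta>] @ rs) s g \<Longrightarrow>
      ccomp X \<psi>' (tid X (tdom X f)) (map (cid X) ps @ [\<theta>] @ map (cid X) rs) =
      ccomp X \<chi> (tid X (tdom X f)) (map (cid X) ps @ [\<theta>] @ map (cid X) rs) \<Longrightarrow> \<psi>' = \<psi>"
    by (elim ex1E) blast
  show ?thesis
    using \<psi>[OF \<chi>(1) refl] \<psi>[OF \<chi>(2) eq[symmetric]] by simp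
qed

lemma cartesianD:
  assumes "cartesian X \<kappa>" "\<kappa> \<in> cells X f [p] q g"
    and "\<chi> \<in> cells X (f \<cdot> f') ps q (g \<cdot> g')"
    and "f' \<in> Tight X" "tcod X f' = tdom X f" "g' \<in> Tight X" "tcod X g' = tdom X g"
  shows "\<exists>!\<psi>. \<psi> \<in> cells X f' ps p g' \<and> ccomp X \<kappa> f' [\<psi>] = \<chi>"
  using assms(1) assms(3-7) cellsD[OF assms(2)] unfolding cartesian_def by auto

lemma cart_factorD:
  assumes "cartesian X \<kappa>" "\<kappa> \<in> cells X f [p] q g"
    and "\<chi> \<in> cells X (f \<cdot> f') ps q (g \<cdot> g')"
    and "f' \<in> Tight X" "tcod X f' = tdom X f" "g' \<in> Tight X" "tcod X g' = tdom X g"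
  shows "cart_factor X \<kappa> f' g' \<chi> \<in> cells X f' ps p g'"
    and "ccomp X \<kappa> f' [cart_factor X \<kappa> f' g' \<chi>] = \<chi>"
  using theI'[OF cartesianD[OF assms]] cellsD[OF assms(2)] cellsD[OF assms(3)]
  by (auto simp: cart_factor_def)

lemma cartesian_bij:
  assumes "cartesian X \<kappa>" "\<kappa> \<in> cells X f [p] q g"
    and "f' \<in> Tight X" "tcod X f' = tdom X f" "g' \<in> Tight X" "tcod X g' = tdom X g"
  shows "bij_betw (\<lambda>\<psi>. ccomp X \<kappa> f' [\<psi>]) (cells X f' ps p g') (cells X (f \<cdot> f') ps q (g \<cdot> g'))"
  by (rule bij_betw_iff_ex1[THEN iffD2, OF _ ballI])
    (simp_all add: ccomp1[OF assms(2)] cartesianD[OF assms(1,2) _ assms(3-6)])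

lemma ccomp_cid_cells:
  assumes "\<phi> \<in> cells X f ps q g"
  shows "ccomp X (cid X q) f [\<phi>] = \<phi>" "tdom X f = A \<Longrightarrow> ccomp X \<phi> (tid X A) (map (cid X) ps) = \<phi>"
  using ccomp_cid_left[of \<phi>] ccomp_cid_right[of \<phi>] cellsD[OF assms] by auto

lemma composable_cids:
  assumes "\<phi> \<in> cells X f ps q g" "tdom X f = A"
  shows "composable X \<phi> (tid X A) (map (cid X) ps)"
  using cellsD[OF assms(1)] chain_cids[of "tdom X f" ps "tdom X g"] assms(2) tight_dom[of f]
  by (auto simp: composable_def)

lemma ccomp_assoc11:
  assumes "\<alpha> \<in> cells X f [q] s g" "\<beta> \<in> cells X h [r] q k" "\<gamma> \<in> cells X m ps r n"
  shows "ccomp X (ccomp X \<alpha> h [\<beta>]) m [\<gamma>] = ccomp X \<alpha> (h \<cdot> m) [ccomp X \<beta> m [\<gamma>]]"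
  by (rule ccomp_assoc1[OF composable1[OF assms(1,2)] composable1[OF assms(2,3)]])

lemma ccomp_assoc12:
  assumes "\<alpha> \<in> cells X f [q] s g" "\<beta> \<in> cells X h [r, r'] q k"
    "\<gamma> \<in> cells X m ps r n" "\<gamma>' \<in> cells X n ps' r' n'"
  shows "ccomp X (ccomp X \<alpha> h [\<beta>]) m [\<gamma>, \<gamma>'] = ccomp X \<alpha> (h \<cdot> m) [ccomp X \<beta> m [\<gamma>, \<gamma>']]"
  by (rule ccomp_assoc1[OF composable1[OF assms(1,2)] composable2[OF assms(2,3,4)]])

lemma ccomp_assoc22:
  assumes "\<alpha> \<in> cells X f [q, q'] s g" "\<beta> \<in> cells X h [r] q k" "\<beta>' \<in> cells X k [r'] q' k'"
    "\<gamma> \<in> cells X m ps r n" "\<gamma>' \<in> cells X n ps' r' n'"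
  shows "ccomp X (ccomp X \<alpha> h [\<beta>, \<beta>']) m [\<gamma>, \<gamma>'] =
    ccomp X \<alpha> (h \<cdot> m) [ccomp X \<beta> m [\<gamma>], ccomp X \<beta>' n [\<gamma>']]"
  using ccomp_assoc2[OF composable2[OF assms(1,2,3)] composable1[OF assms(2,4)], of "[\<gamma>']"]
    composable1[OF assms(3,5)] cellsD(5)[OF assms(4)] by simp

lemma cartesianI:
  assumes \<kappa>: "\<kappa> \<in> cells X f [p] q g"
    and "\<And>f' g' ps \<chi>. f' \<in> Tight X \<Longrightarrow> tcod X f' = tdom X f \<Longrightarrow> g' \<in> Tight X \<Longrightarrow>
      tcod X g' = tdom X g \<Longrightarrow> \<chi> \<in> cells X (f \<cdot> f') ps q (g \<cdot> g') \<Longrightarrow>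
      \<exists>!\<psi>. \<psi> \<in> cells X f' ps p g' \<and> ccomp X \<kappa> f' [\<psi>] = \<chi>"
  shows "cartesian X \<kappa>"
  unfolding cartesian_def using assms(2) cellsD[OF \<kappa>] by simp

lemma tight_assoc:
  assumes "f \<in> Tight X" "g \<in> Tight X" "h \<in> Tight X" "tcod X f = tdom X g" "tcod X g = tdom X h"
  shows "(h \<cdot> g) \<cdot> f = h \<cdot> (g \<cdot> f)"
  by (rule tcomp_assoc) (use assms in \<open>auto intro: tight_homI\<close>)

text \<open>As for pullback squares: postcomposition with \<open>\<kappa>\<close> is injective, so
  factorising \<open>\<chi>\<close> through \<open>\<rho>\<close> is the same as factorising the
  composite of \<open>\<kappa>\<close> and \<open>\<chi>\<close> through that of
  \<open>\<kappa>\<close> and \<open>\<rho>\<close>.\<close>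

lemma cartesian_cancel:
  assumes "cartesian X \<kappa>" and \<kappa>: "\<kappa> \<in> cells X f [p] q g" and \<rho>: "\<rho> \<in> cells X x [p'] p y"
    and c: "cartesian X (ccomp X \<kappa> x [\<rho>])"
  shows "cartesian X \<rho>"
proof (rule cartesianI[OF \<rho>])
  fix f' g' ps \<chi>
  assume f': "f' \<in> Tight X" "tcod X f' = tdom X x" and g': "g' \<in> Tight X" "tcod X g' = tdom X y"
    and \<chi>: "\<chi> \<in> cells X (x \<cdot> f') ps p (y \<cdot> g')"
  note k = cellsD[OF \<kappa>] and r = cellsD[OF \<rho>]
  have a: "(f \<cdot> x) \<cdot> f' = f \<cdot> (x \<cdot> f')" "(g \<cdot> y) \<cdot> g' = g \<cdot> (y \<cdot> g')"
    using k r f' g' by (auto intro!: tight_assoc)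
  have as: "ccomp X (ccomp X \<kappa> x [\<rho>]) f' [\<psi>] = ccomp X \<kappa> (x \<cdot> f') [ccomp X \<rho> f' [\<psi>]]"
    if "\<psi> \<in> cells X f' ps p' g'" for \<psi>
    by (rule ccomp_assoc11[OF \<kappa> \<rho> that])
  have ex: "\<exists>!\<psi>. \<psi> \<in> cells X f' ps p' g' \<and>
      ccomp X (ccomp X \<kappa> x [\<rho>]) f' [\<psi>] = ccomp X \<kappa> (x \<cdot> f') [\<chi>]"
    by (rule cartesianD[OF c ccomp1[OF \<kappa> \<rho>]]) (use ccomp1[OF \<kappa> \<chi>] a f' g' k r in auto)
  have inj: "inj_on (\<lambda>\<psi>. ccomp X \<kappa> (x \<cdot> f') [\<psi>]) (cells X (x \<cdot> f') ps p (y \<cdot> g'))"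
    by (rule bij_betw_imp_inj_on[OF cartesian_bij[OF assms(1) \<kappa>]]) (use f' g' k r in auto)
  have "ccomp X (ccomp X \<kappa> x [\<rho>]) f' [\<psi>] = ccomp X \<kappa> (x \<cdot> f') [\<chi>] \<longleftrightarrow> ccomp X \<rho> f' [\<psi>] = \<chi>"
    if "\<psi> \<in> cells X f' ps p' g'" for \<psi>
    unfolding as[OF that] using inj_on_eq_iff[OF inj ccomp1[OF \<rho> that] \<chi>] by simp
  then show "\<exists>!\<psi>. \<psi> \<in> cells X f' ps p' g' \<and> ccomp X \<rho> f' [\<psi>] = \<chi>"
    using ex by (simp cong: conj_cong)
qed

text \<open>The inverse of \<open>\<phi>\<close> converts factorisations through
  \<open>\<kappa>\<close> into factorisations through the composite and back. Applied to E(j,r),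
  this makes C(l,1) a restriction along \<open>j\<close> and \<open>r\<close>.\<close>

lemma cartesian_iso:
  assumes "cartesian X \<kappa>" and \<kappa>: "\<kappa> \<in> cells X f [q] s g" and iso: "loose_iso X \<phi> p q"
  shows "cartesian X (ccomp X \<kappa> (tid X (ltgt X q)) [\<phi>])"
    and "ccomp X \<kappa> (tid X (ltgt X q)) [\<phi>] \<in> cells X f [p] s g"
proof -
  let ?D = "tid X (ltgt X q)" and ?C = "tid X (lsrc X q)"
  note k = cellsD[OF \<kappa>]
  from iso obtain \<psi> where \<phi>: "\<phi> \<in> cells X ?D [p] q ?C"
    and \<psi>: "\<psi> \<in> cells X (tid X (ltgt X p)) [q] p (tid X (lsrc X p))"
    and inv: "ccomp X \<psi> (tid X (ltgt X p)) [\<phi>] = cid X p" "ccomp X \<phi> ?D [\<psi>] = cid X q"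
    unfolding loose_iso_def gcells_def by blast
  note f = cellsD[OF \<phi>] and g = cellsD[OF \<psi>]
  have q: "q \<in> Loose X" "ltgt X q = tdom X f" "lsrc X q = tdom X g"
    and p: "ltgt X p = tdom X f" "lsrc X p = tdom X g"
    and ob: "tdom X f \<in> Obj X" "tdom X g \<in> Obj X"
    using k f tight_dom by auto
  note \<phi> = \<phi>[unfolded q] and \<psi> = \<psi>[unfolded p] and inv = inv[unfolded q p]
  show \<kappa>\<phi>: "ccomp X \<kappa> ?D [\<phi>] \<in> cells X f [p] s g"
    using ccomp1[OF \<kappa> \<phi>] k q by simp
  show "cartesian X (ccomp X \<kappa> ?D [\<phi>])"
  proof (rule cartesianI[OF \<kappa>\<phi>])
    fix f' g' ps \<chi>
    assume f': "f' \<in> Tight X" "tcod X f' = tdom X f" and g': "g' \<in> Tight X" "tcod X g' = tdom X g"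
      and \<chi>: "\<chi> \<in> cells X (f \<cdot> f') ps s (g \<cdot> g')"
    obtain \<xi> where \<xi>: "\<xi> \<in> cells X f' ps q g'" "ccomp X \<kappa> f' [\<xi>] = \<chi>"
      and uniq: "\<And>\<xi>'. \<xi>' \<in> cells X f' ps q g' \<Longrightarrow> ccomp X \<kappa> f' [\<xi>'] = \<chi> \<Longrightarrow> \<xi>' = \<xi>"
      using cartesianD[OF assms(1) \<kappa> \<chi> f' g'] by (elim ex1E) blast
    have as: "ccomp X (ccomp X \<kappa> ?D [\<phi>]) f' [\<theta>] = ccomp X \<kappa> f' [ccomp X \<phi> f' [\<theta>]]"
      if "\<theta> \<in> cells X f' ps p g'" for \<theta>
      using ccomp_assoc11[OF \<kappa> \<phi> that] f' q by simp
    have \<phi>t: "ccomp X \<phi> f' [\<theta>] \<in> cells X f' ps q g'" if "\<theta> \<in> cells X f' ps p g'" for \<theta>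
      using ccomp1[OF \<phi> that] f' g' by simp
    have \<psi>t: "ccomp X \<psi> f' [\<xi>] \<in> cells X f' ps p g'"
      using ccomp1[OF \<psi> \<xi>(1)] f' g' by simp
    have 1: "ccomp X \<phi> f' [ccomp X \<psi> f' [\<xi>]] = \<xi>"
      using ccomp_assoc11[OF \<phi> \<psi> \<xi>(1)] inv ccomp_cid_cells(1)[OF \<xi>(1)] f' by simp
    have 2: "ccomp X \<psi> f' [ccomp X \<phi> f' [\<theta>]] = \<theta>" if "\<theta> \<in> cells X f' ps p g'" for \<theta>
      using ccomp_assoc11[OF \<psi> \<phi> that] inv ccomp_cid_cells(1)[OF that] f' by simp
    show "\<exists>!\<psi>. \<psi> \<in> cells X f' ps p g' \<and> ccomp X (ccomp X \<kappa> ?D [\<phi>]) f' [\<psi>] = \<chi>"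
    proof (rule ex1I[of _ "ccomp X \<psi> f' [\<xi>]"])
      show "ccomp X \<psi> f' [\<xi>] \<in> cells X f' ps p g' \<and>
        ccomp X (ccomp X \<kappa> ?D [\<phi>]) f' [ccomp X \<psi> f' [\<xi>]] = \<chi>"
        using \<psi>t as[OF \<psi>t] 1 \<xi>(2) by simp
    next
      fix \<theta> assume \<theta>: "\<theta> \<in> cells X f' ps p g' \<and> ccomp X (ccomp X \<kappa> ?D [\<phi>]) f' [\<theta>] = \<chi>"
      then have "ccomp X \<phi> f' [\<theta>] = \<xi>"
        using as by (intro uniq \<phi>t) auto
      then show "\<theta> = ccomp X \<psi> f' [\<xi>]"
        using 2 \<theta> by metis
    qed
  qed
qed

end

subsection \<open>Virtual equipments\<close>

context virtual_equipment
begin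

section \<open>Loose-identities as monoids\<close>

lemma lid_cell:
  assumes "A \<in> Obj X"
  shows "opcartesian X (lid_cell X A)" "cdom X (lid_cell X A) = []" "ccod X (lid_cell X A) = lid X A"
    "lid_cell X A \<in> cells X (tid X A) [] (lid X A) (tid X A)"
    "lid X A \<in> Loose X" "lsrc X (lid X A) = A" "ltgt X (lid X A) = A"
    "cid X (lid X A) \<in> cells X (tid X A) [lid X A] (lid X A) (tid X A)"
proof -
  have "is_lid_cell X A (lid_cell X A)"
    using ex_lid[OF assms] unfolding lid_cell_def by (rule someI_ex)
  then show *: "opcartesian X (lid_cell X A)" "cdom X (lid_cell X A) = []"
    "ccod X (lid_cell X A) = lid X A" "lid X A \<in> Loose X" "lsrc X (lid X A) = A"
    "ltgt X (lid X A) = A"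
    by (simp_all add: is_lid_cell_def lid_def loose_hom_def)
  then show "lid_cell X A \<in> cells X (tid X A) [] (lid X A) (tid X A)"
    by (simp add: opcartesian_def gcells_def)
  show "cid X (lid X A) \<in> cells X (tid X A) [lid X A] (lid X A) (tid X A)"
    using cid_cells[of "lid X A"] * by simp
qed

text \<open>A 2-cell with a loose-identity in its domain is determined by inserting the unit there.
  Equations about loose-identities are checked this way.\<close>

lemma lid_eqI:
  assumes "A \<in> Obj X" "\<chi> \<in> cells X f (ps @ [lid X A] @ rs) s g"
    "\<chi>' \<in> cells X f (ps @ [lid X A] @ rs) s g"
    and "ccomp X \<chi> (tid X (tdom X f)) (map (cid X) ps @ [lid_cell X A] @ map (cid X) rs) =
      ccomp X \<chi>' (tid X (tdom X f)) (map (cid X) ps @ [lid_cell X A] @ map (cid X) rs)"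
  shows "\<chi> = \<chi>'"
  using opcartesian_eqI[OF lid_cell(1)[OF assms(1)], of \<chi> f ps rs s g \<chi>'] assms lid_cell(3) by simp

lemma lid_mult:
  assumes "A \<in> Obj X"
  shows "lid_mult X A \<in> cells X (tid X A) [lid X A, lid X A] (lid X A) (tid X A)"
    "ccomp X (lid_mult X A) (tid X A) [cid X (lid X A), lid_cell X A] = cid X (lid X A)"
  using opcart_factorD[OF lid_cell(1)[OF assms], of "cid X (lid X A)" "tid X A" "[lid X A]" "[]"
      "lid X A" "tid X A"] lid_cell[OF assms] assms
  by (simp_all add: lid_mult_def)

lemma lid_cell_tid: "A \<in> Obj X \<Longrightarrow> ccomp X (lid_cell X A) (tid X A) [] = lid_cell X A"
  using ccomp_cid_cells(2)[OF lid_cell(4), of A A] by simp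

text \<open>For the loose-identity itself this unit law is the defining property of
  \<open>lid_mult\<close>; the general case substitutes \<open>\<psi>\<close> and \<open>x\<close>
  into it. Precomposing \<open>lid_cell X B\<close> with \<open>x\<close> gives the identity of
  \<open>x\<close>.\<close>

lemma lid_mult_unit_right:
  assumes "\<psi> \<in> cells X f ps (lid X B) x" "B \<in> Obj X"
  shows "ccomp X (lid_mult X B) f [\<psi>, ccomp X (lid_cell X B) x []] = \<psi>"
proof -
  note u = lid_cell[OF assms(2)] and m = lid_mult[OF assms(2)] and c = cellsD[OF assms(1)]
  have t: "tcod X f = B" "tcod X x = B"
    using u(6,7) c(10,11) by simp_all
  have "ccomp X (ccomp X (lid_mult X B) (tid X B) [cid X (lid X B), lid_cell X B]) f ([\<psi>] @ []) =
    ccomp X (lid_mult X B) (tid X B \<cdot> f) [ccomp X (cid X (lid X B)) f [\<psi>],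
      ccomp X (lid_cell X B) (cpath_right X f [\<psi>]) []]"
    using c t assms(2)
    by (intro ccomp_assoc2 composable2[OF m(1) u(8,4)] composable1[OF u(8) assms(1)]
        composable0[OF u(4)]) simp_all
  then show ?thesis
    using m(2) ccomp_cid_cells(1)[OF assms(1)] c t by simp
qed

text \<open>On this side the unit law is not built into \<open>lid_mult\<close>. Inserting the unit
  into the remaining input leaves the product of two units, which the other unit law
  evaluates.\<close>

lemma lid_mult_unit:
  assumes "A \<in> Obj X"
  shows "ccomp X (lid_mult X A) (tid X A) [lid_cell X A, cid X (lid X A)] = cid X (lid X A)"
proof (rule lid_eqI[OF assms, of _ "tid X A" "[]" "[]", simplified])
  note u = lid_cell[OF assms] and m = lid_mult[OF assms]
  show "ccomp X (lid_mult X A) (tid X A) [lid_cell X A, cid X (lid X A)]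
    \<in> cells X (tid X A) [lid X A] (lid X A) (tid X A)"
    using ccomp2[OF m(1) u(4,8)] assms by simp
  show "cid X (lid X A) \<in> cells X (tid X A) [lid X A] (lid X A) (tid X A)" by (fact u(8))
  \<comment> \<open>\<open>lid_cell X A\<close> has no inputs, so it receives the empty block, and
    the inserted unit goes to the identity next to it.\<close>
  have "ccomp X (ccomp X (lid_mult X A) (tid X A) [lid_cell X A, cid X (lid X A)]) (tid X A)
      ([] @ [lid_cell X A]) = ccomp X (lid_mult X A) (tid X A \<cdot> tid X A)
      [ccomp X (lid_cell X A) (tid X A) [],
       ccomp X (cid X (lid X A)) (cpath_right X (tid X A) []) [lid_cell X A]]"
    using assms by (intro ccomp_assoc2 composable2[OF m(1) u(4,8)] composable0[OF u(4)])
      (simp_all add: composable1[OF u(8,4)])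
  also have "\<dots> = ccomp X (lid_mult X A) (tid X A) [lid_cell X A, ccomp X (lid_cell X A) (tid X A) []]"
    using ccomp_cid_cells(1)[OF u(4)] assms by (simp add: lid_cell_tid)
  also have "\<dots> = lid_cell X A"
    by (rule lid_mult_unit_right[OF u(4) assms])
  finally show "ccomp X (ccomp X (lid_mult X A) (tid X A) [lid_cell X A, cid X (lid X A)])
      (tid X (tdom X (tid X A))) [lid_cell X A] =
      ccomp X (cid X (lid X A)) (tid X (tdom X (tid X A))) [lid_cell X A]"
    using ccomp_cid_cells(1)[OF u(4)] assms by simp
qed

lemma lid_mult_unit_left:
  assumes "\<psi> \<in> cells X f ps (lid X B) x" "B \<in> Obj X"
  shows "ccomp X (lid_mult X B) f [ccomp X (lid_cell X B) f [], \<psi>] = \<psi>"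
proof -
  note u = lid_cell[OF assms(2)] and m = lid_mult[OF assms(2)] and c = cellsD[OF assms(1)]
  have t: "tcod X f = B" "tcod X x = B"
    using u(6,7) c(10,11) by simp_all
  have "ccomp X (ccomp X (lid_mult X B) (tid X B) [lid_cell X B, cid X (lid X B)]) f ([] @ [\<psi>]) =
    ccomp X (lid_mult X B) (tid X B \<cdot> f) [ccomp X (lid_cell X B) f [],
      ccomp X (cid X (lid X B)) (cpath_right X f []) [\<psi>]]"
    using c t assms(2)
    by (intro ccomp_assoc2 composable2[OF m(1) u(4,8)]
        composable0[OF u(4)]) (simp_all add: composable1[OF u(8) assms(1)])
  then show ?thesis
    using lid_mult_unit[OF assms(2)] ccomp_cid_cells(1)[OF assms(1)] c t by simp
qed

lemma lid_mult_cells: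
  assumes "B \<in> Obj X" "a \<in> cells X f ps (lid X B) g" "b \<in> cells X g qs (lid X B) h"
  shows "ccomp X (lid_mult X B) f [a, b] \<in> cells X f (ps @ qs) (lid X B) h"
    and "composable X (lid_mult X B) f [a, b]"
  using ccomp2[OF lid_mult(1) assms(2,3)] composable2[OF lid_mult(1) assms(2,3)]
    cellsD[OF assms(2)] cellsD[OF assms(3)] lid_cell[OF assms(1)] assms(1) by simp_all

text \<open>Inserting the unit in the last of the three positions reduces both sides to
  \<open>m\<close>, by the right unit law.\<close>

lemma lid_mult_assoc_lid:
  assumes "A \<in> Obj X"
  defines "m \<equiv> lid_mult X A" and "i \<equiv> tid X A" and "e \<equiv> cid X (lid X A)"
  shows "ccomp X m i [m, e] = ccomp X m i [e, m]"
proof -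
  note u = lid_cell[OF assms(1), folded e_def i_def]
    and m = lid_mult[OF assms(1), folded e_def m_def i_def]
    and mc = lid_mult_cells[OF assms(1), folded m_def]
  have i: "i \<cdot> i = i" "tdom X i = A"
    using assms(1) by (simp_all add: i_def)
  have ui: "ccomp X (lid_cell X A) i [] = lid_cell X A"
    using lid_cell_tid[OF assms(1)] by (simp add: i_def)
  have "ccomp X (ccomp X m i [m, e]) i ([e, e] @ [lid_cell X A]) =
     ccomp X m (i \<cdot> i) [ccomp X m i [e, e], ccomp X e (cpath_right X i [e, e]) [lid_cell X A]]"
    using cellsD(5)[OF u(8)] by (intro ccomp_assoc2 mc(2)[OF m(1) u(8)] mc(2)[OF u(8,8)])
      (simp_all add: composable1[OF u(8,4)])
  also have "\<dots> = ccomp X m i [m, ccomp X (lid_cell X A) i []]"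
    using ccomp_cid_cells(2)[OF m(1) i(2)] ccomp_cid_cells(1)[OF u(4)] cellsD(5)[OF u(8)]
    by (simp add: i ui flip: e_def i_def)
  also have "\<dots> = m"
    using lid_mult_unit_right[OF m(1) assms(1)] by (simp add: m_def)
  finally have 1: "ccomp X (ccomp X m i [m, e]) i [e, e, lid_cell X A] = m" by simp
  have "ccomp X (ccomp X m i [e, m]) i ([e] @ [e, lid_cell X A]) =
     ccomp X m (i \<cdot> i) [ccomp X e i [e], ccomp X m (cpath_right X i [e]) [e, lid_cell X A]]"
    using cellsD(5)[OF u(8)]
    by (intro ccomp_assoc2 mc(2)[OF u(8) m(1)] composable1[OF u(8,8)])
      (simp_all add: mc(2)[OF u(8,4)])
  also have "\<dots> = ccomp X m i [e, e]"
    using ccomp_cid_cells(1)[OF u(8)] cellsD(5)[OF u(8)] m(2)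
    by (simp add: i flip: e_def i_def)
  also have "\<dots> = m"
    using ccomp_cid_cells(2)[OF m(1) i(2)] by (simp flip: e_def i_def)
  finally have 2: "ccomp X (ccomp X m i [e, m]) i [e, e, lid_cell X A] = m" by simp
  show ?thesis
    by (rule lid_eqI[OF assms(1), where ps = "[lid X A, lid X A]" and rs = "[]" and f = i])
      (use 1 2 mc(1)[OF m(1) u(8)] mc(1)[OF u(8) m(1)] i(2) in
        \<open>simp_all flip: e_def i_def\<close>)
qed

text \<open>Substituting \<open>a\<close>, \<open>b\<close>, \<open>c\<close> into the associative
  law for the loose-identity gives both sides.\<close>

lemma lid_mult_assoc:
  assumes "B \<in> Obj X" "a \<in> cells X f ps (lid X B) g" "b \<in> cells X g qs (lid X B) h"
    "c \<in> cells X h rs (lid X B) k"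
  defines "m \<equiv> lid_mult X B"
  shows "ccomp X m f [ccomp X m f [a, b], c] = ccomp X m f [a, ccomp X m g [b, c]]"
proof -
  let ?i = "tid X B" and ?e = "cid X (lid X B)"
  note u = lid_cell[OF assms(1)]
    and m = lid_mult[OF assms(1), folded m_def]
    and mc = lid_mult_cells[OF assms(1), folded m_def]
    and a = cellsD[OF assms(2)] and b = cellsD[OF assms(3)] and c = cellsD[OF assms(4)]
  have f: "?i \<cdot> f = f" "?i \<cdot> g = g"
    using u(6,7) a by simp_all
  have "ccomp X (ccomp X m ?i [m, ?e]) f ([a, b] @ [c]) =
     ccomp X m (?i \<cdot> f) [ccomp X m f [a, b], ccomp X ?e (cpath_right X f [a, b]) [c]]"
    using b by (intro ccomp_assoc2 mc(2)[OF m(1) u(8)] mc(2)[OF assms(2,3)])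
      (simp_all add: composable1[OF u(8) assms(4)])
  then have 1: "ccomp X (ccomp X m ?i [m, ?e]) f [a, b, c] = ccomp X m f [ccomp X m f [a, b], c]"
    using ccomp_cid_cells(1)[OF assms(4)] b f by simp
  have "ccomp X (ccomp X m ?i [?e, m]) f ([a] @ [b, c]) =
     ccomp X m (?i \<cdot> f) [ccomp X ?e f [a], ccomp X m (cpath_right X f [a]) [b, c]]"
    using a by (intro ccomp_assoc2 mc(2)[OF u(8) m(1)] composable1[OF u(8) assms(2)])
      (simp_all add: mc(2)[OF assms(3,4)])
  then have 2: "ccomp X (ccomp X m ?i [?e, m]) f [a, b, c] = ccomp X m f [a, ccomp X m g [b, c]]"
    using ccomp_cid_cells(1)[OF assms(2)] a f by simp
  show ?thesis
    using 1 2 lid_mult_assoc_lid[OF assms(1)] by (simp add: m_def)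
qed

section \<open>Restrictions of loose-identities and their composition\<close>

lemma hom_cell:
  assumes "f \<in> Tight X" "g \<in> Tight X" "tcod X f = B" "tcod X g = B"
  shows "cartesian X (hom_cell X f g)" "hom_cell X f g \<in> cells X f [hom X f g] (lid X B) g"
    "hom X f g \<in> Loose X" "lsrc X (hom X f g) = tdom X g" "ltgt X (hom X f g) = tdom X f"
proof -
  have "B \<in> Obj X"
    using assms tight_cod by auto
  note u = lid_cell[OF this]
  have "\<exists>\<kappa>. is_restr_cell X (lid X B) f g \<kappa>"
    by (rule ex_restr) (use u assms in simp_all)
  then have "is_restr_cell X (lid X B) f g (restr_cell X (lid X B) f g)"
    unfolding restr_cell_def by (rule someI_ex)
  then have *: "cartesian X (hom_cell X f g)" "ccod X (hom_cell X f g) = lid X B"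
    "cleft X (hom_cell X f g) = f" "cright X (hom_cell X f g) = g"
    using assms by (simp_all add: is_restr_cell_def hom_cell_def)
  then show "cartesian X (hom_cell X f g)" by simp
  show c: "hom_cell X f g \<in> cells X f [hom X f g] (lid X B) g"
    using * by (auto simp: cells_def cartesian_def hom_def restr_def hom_cell_def)
  show "hom X f g \<in> Loose X" "lsrc X (hom X f g) = tdom X g" "ltgt X (hom X f g) = tdom X f"
    using cellsD[OF c] by simp_all
qed

text \<open>Its composite with the cartesian \<open>hom_cell X f g\<close> is again a
  \<open>hom_cell\<close>, so cartesianness follows by cancellation.\<close>

lemma hom_restr_cell:
  assumes "f \<in> Tight X" "g \<in> Tight X" "tcod X f = tcod X g"
    and "x \<in> Tight X" "tcod X x = tdom X f" "y \<in> Tight X" "tcod X y = tdom X g"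
  shows "hom_restr_cell X f g x y \<in> cells X x [hom X (f \<cdot> x) (g \<cdot> y)] (hom X f g) y"
    "ccomp X (hom_cell X f g) x [hom_restr_cell X f g x y] = hom_cell X (f \<cdot> x) (g \<cdot> y)"
    "cartesian X (hom_restr_cell X f g x y)"
proof -
  note h = hom_cell[OF assms(1-2) assms(3) refl]
  have h': "cartesian X (hom_cell X (f \<cdot> x) (g \<cdot> y))"
    "hom_cell X (f \<cdot> x) (g \<cdot> y) \<in> cells X (f \<cdot> x) [hom X (f \<cdot> x) (g \<cdot> y)] (lid X (tcod X g)) (g \<cdot> y)"
    using hom_cell[of "f \<cdot> x" "g \<cdot> y" "tcod X g"] assms by simp_all
  show *: "hom_restr_cell X f g x y \<in> cells X x [hom X (f \<cdot> x) (g \<cdot> y)] (hom X f g) y"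
    "ccomp X (hom_cell X f g) x [hom_restr_cell X f g x y] = hom_cell X (f \<cdot> x) (g \<cdot> y)"
    using cart_factorD[OF h(1,2) h'(2) assms(4-7)] by (simp_all add: hom_restr_cell_def)
  show "cartesian X (hom_restr_cell X f g x y)"
    using cartesian_cancel[OF h(1,2) *(1)] *(2) h' by simp
qed

text \<open>The second equation is the point: under \<open>hom_cell X x y\<close>, composition of
  homs becomes multiplication of 2-cells into the loose-identity. The restriction 2-cells in the
  definition are absorbed by the two \<open>hom_cell\<close>s inside \<open>cup\<close>.\<close>

lemma cup_restr:
  assumes "c \<in> Tight X" "x \<in> Tight X" "y \<in> Tight X" "tcod X c = B" "tcod X x = B" "tcod X y = B"
  shows "cup_restr X c x y \<in>
      cells X (tid X (tdom X x)) [hom X x c, hom X c y] (hom X x y) (tid X (tdom X y))"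
    and "ccomp X (hom_cell X x y) (tid X (tdom X x)) [cup_restr X c x y] =
      ccomp X (lid_mult X B) x [hom_cell X x c, hom_cell X c y]"
proof -
  let ?i = "tid X B" and ?k = "tid X (tdom X c)"
  have ob: "B \<in> Obj X" "tdom X c \<in> Obj X" "tdom X x \<in> Obj X" "tdom X y \<in> Obj X"
    using assms tight_dom tight_cod by auto
  note m = lid_mult[OF ob(1)]
  have i: "?i \<cdot> x = x" "?i \<cdot> y = y" "?i \<cdot> c = c" "c \<cdot> ?k = c"
    using assms by simp_all
  have h1: "hom_cell X ?i c \<in> cells X ?i [hom X ?i c] (lid X B) c"
    and h2: "hom_cell X c ?i \<in> cells X c [hom X c ?i] (lid X B) ?i"
    using assms ob by (simp_all add: hom_cell)
  have r1: "hom_restr_cell X ?i c x ?k \<in> cells X x [hom X x c] (hom X ?i c) ?k"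
    "ccomp X (hom_cell X ?i c) x [hom_restr_cell X ?i c x ?k] = hom_cell X x c"
    using hom_restr_cell[of ?i c x ?k] i assms ob by simp_all
  have r2: "hom_restr_cell X c ?i ?k y \<in> cells X ?k [hom X c y] (hom X c ?i) y"
    "ccomp X (hom_cell X c ?i) ?k [hom_restr_cell X c ?i ?k y] = hom_cell X c y"
    using hom_restr_cell[of c ?i ?k y] i assms ob by simp_all
  have cup: "ccomp X (cup X c) x [hom_restr_cell X ?i c x ?k, hom_restr_cell X c ?i ?k y] =
    ccomp X (lid_mult X B) x [hom_cell X x c, hom_cell X c y]"
    using ccomp_assoc22[OF m(1) h1 h2 r1(1) r2(1)] r1(2) r2(2) i assms(4)
    by (simp add: cup_def Let_def)
  have "ccomp X (lid_mult X B) x [hom_cell X x c, hom_cell X c y]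
    \<in> cells X x [hom X x c, hom X c y] (lid X B) y"
    using lid_mult_cells(1)[OF ob(1) hom_cell(2) hom_cell(2)] assms by fastforce
  then have "ccomp X (lid_mult X B) x [hom_cell X x c, hom_cell X c y]
    \<in> cells X (x \<cdot> tid X (tdom X x)) [hom X x c, hom X c y] (lid X B) (y \<cdot> tid X (tdom X y))"
    using assms by simp
  from cart_factorD[OF hom_cell(1,2)[OF assms(2,3,5,6)] this] ob
  show "cup_restr X c x y \<in>
      cells X (tid X (tdom X x)) [hom X x c, hom X c y] (hom X x y) (tid X (tdom X y))"
    and "ccomp X (hom_cell X x y) (tid X (tdom X x)) [cup_restr X c x y] =
      ccomp X (lid_mult X B) x [hom_cell X x c, hom_cell X c y]"
    unfolding cup_restr_def Let_def assms(4) cup by simp_all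
qed

section \<open>The action of a tight-cell on 2-cells into a loose-identity\<close>

text \<open>\<open>action g\<close> is the action \<open>A(1,1) \<Rightarrow> B(1,1)\<close> of \<open>g : A \<rightarrow> B\<close>; whiskering with it applies \<open>g\<close> to a
  2-cell into \<open>A(1,1)\<close>.\<close>

definition action :: "'t \<Rightarrow> 'c" where
  "action g = opcart_factor X (lid_cell X (tdom X g)) [] [] (ccomp X (lid_cell X (tcod X g)) g [])"

lemma action:
  assumes "g \<in> tight_hom X A B"
  shows "action g \<in> cells X g [lid X A] (lid X B) g"
    "ccomp X (action g) (tid X A) [lid_cell X A] = ccomp X (lid_cell X B) g []"
proof -
  note g = tight_homD[OF assms]
  have "ccomp X (lid_cell X B) g [] \<in> cells X g [] (lid X B) g"
    using ccomp0[OF lid_cell(4)[OF g(5)] g(1)] g by simp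
  then show "action g \<in> cells X g [lid X A] (lid X B) g"
    "ccomp X (action g) (tid X A) [lid_cell X A] = ccomp X (lid_cell X B) g []"
    using opcart_factorD[OF lid_cell(1)[OF g(4)], of "ccomp X (lid_cell X B) g []" g "[]" "[]"]
      lid_cell[OF g(4)] g by (simp_all add: action_def)
qed

text \<open>Both 2-cells out of A(1,1) become the identity of \<open>g\<close> when the unit is
  inserted, hence agree. This is the link from \<open>cap\<close> to \<open>action\<close>.\<close>

lemma action_eq_cap:
  assumes "g \<in> tight_hom X A B"
  shows "opcart_factor X (lid_cell X A) [] [] (cap X g) \<in> cells X (tid X A) [lid X A] (hom X g g) (tid X A)"
    "ccomp X (hom_cell X g g) (tid X A) [opcart_factor X (lid_cell X A) [] [] (cap X g)] = action g"
proof -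
  note g = tight_homD[OF assms] and u = lid_cell[OF tight_homD(4)[OF assms]]
  note h = hom_cell(1,2)[OF g(1,1,3,3)]
  let ?o = "opcart_factor X (lid_cell X A) [] [] (cap X g)"
  have "ccomp X (lid_cell X B) g [] \<in> cells X (g \<cdot> tid X A) [] (lid X B) (g \<cdot> tid X A)"
    using ccomp0[OF lid_cell(4)[OF g(5)] g(1)] g by simp
  from cart_factorD[OF h this] g
  have cap: "cap X g \<in> cells X (tid X A) [] (hom X g g) (tid X A)"
    "ccomp X (hom_cell X g g) (tid X A) [cap X g] = ccomp X (lid_cell X B) g []"
    by (simp_all add: cap_def)
  show o: "?o \<in> cells X (tid X A) [lid X A] (hom X g g) (tid X A)"
    using opcart_factorD(1)[OF u(1), of "cap X g" "tid X A" "[]" "[]" "hom X g g" "tid X A"] cap u g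
    by simp
  have oc: "ccomp X ?o (tid X A) [lid_cell X A] = cap X g"
    using opcart_factorD(2)[OF u(1), of "cap X g" "tid X A" "[]" "[]" "hom X g g" "tid X A"] cap u g
    by simp
  have "ccomp X (ccomp X (hom_cell X g g) (tid X A) [?o]) (tid X A) [lid_cell X A] =
    ccomp X (action g) (tid X A) [lid_cell X A]"
    using ccomp_assoc11[OF h(2) o u(4)] oc cap action(2)[OF assms] g by simp
  then show "ccomp X (hom_cell X g g) (tid X A) [?o] = action g"
    using lid_eqI[OF g(4), of _ g "[]" "[]"] ccomp1[OF h(2) o] action(1)[OF assms] g by simp
qed

text \<open>Under the \<open>hom_cell\<close> of the target the restriction is undone, and what
  remains is \<open>action g\<close> applied to \<open>hom_cell X x y\<close>.\<close>

lemma cap_restr: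
  assumes "g \<in> tight_hom X A B" "x \<in> tight_hom X Z A" "y \<in> tight_hom X Y A"
  shows "cap_restr X g x y \<in> cells X (tid X Z) [hom X x y] (hom X (g \<cdot> x) (g \<cdot> y)) (tid X Y)"
    "ccomp X (hom_cell X (g \<cdot> x) (g \<cdot> y)) (tid X Z) [cap_restr X g x y] =
      ccomp X (action g) x [hom_cell X x y]"
proof -
  note g = tight_homD[OF assms(1)] and x = tight_homD[OF assms(2)] and y = tight_homD[OF assms(3)]
  let ?o = "opcart_factor X (lid_cell X A) [] [] (cap X g)"
  note o = action_eq_cap[OF assms(1)]
  note h = hom_cell(1,2)[OF x(1) y(1) x(3) y(3)]
  have r: "hom_restr_cell X g g x y \<in> cells X x [hom X (g \<cdot> x) (g \<cdot> y)] (hom X g g) y"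
    "ccomp X (hom_cell X g g) x [hom_restr_cell X g g x y] = hom_cell X (g \<cdot> x) (g \<cdot> y)"
    "cartesian X (hom_restr_cell X g g x y)"
    using hom_restr_cell[of g g x y] g x y by simp_all
  have oh: "ccomp X ?o x [hom_cell X x y] \<in> cells X (x \<cdot> tid X Z) [hom X x y] (hom X g g) (y \<cdot> tid X Y)"
    using ccomp1[OF o(1) h(2)] x y by simp
  have c: "cap_restr X g x y \<in> cells X (tid X Z) [hom X x y] (hom X (g \<cdot> x) (g \<cdot> y)) (tid X Y)"
    "ccomp X (hom_restr_cell X g g x y) (tid X Z) [cap_restr X g x y] =
      ccomp X ?o x [hom_cell X x y]"
    using cart_factorD[OF r(3,1) oh] g x y by (simp_all add: cap_restr_def)
  then show "cap_restr X g x y \<in> cells X (tid X Z) [hom X x y] (hom X (g \<cdot> x) (g \<cdot> y)) (tid X Y)"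
    by simp
  note hg = hom_cell(2)[OF g(1,1,3,3)]
  have "ccomp X (hom_cell X (g \<cdot> x) (g \<cdot> y)) (tid X Z) [cap_restr X g x y] =
    ccomp X (hom_cell X g g) x [ccomp X ?o x [hom_cell X x y]]"
    using ccomp_assoc11[OF hg r(1) c(1)] r(2) c(2) x by simp
  also have "\<dots> = ccomp X (action g) x [hom_cell X x y]"
    using ccomp_assoc11[OF hg o(1) h(2)] o(2) x by simp
  finally show "ccomp X (hom_cell X (g \<cdot> x) (g \<cdot> y)) (tid X Z) [cap_restr X g x y] =
      ccomp X (action g) x [hom_cell X x y]" .
qed

subsection \<open>Colimits in terms of 2-cells into loose-identities\<close>

text \<open>The identity of \<open>x\<close>, with its right tight-cell read as
  \<open>tid X B \<cdot> x\<close>, factors through the cartesian 2-cell of B(x,1). The factor is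
  the unit of the companion, and the equation is one of the companion identities.\<close>

lemma companion_unit:
  assumes "x \<in> tight_hom X D B"
  obtains \<eta> where "\<eta> \<in> cells X (tid X D) [] (hom X x (tid X B)) x"
    "ccomp X (hom_cell X x (tid X B)) (tid X D) [\<eta>] = ccomp X (lid_cell X B) x []"
proof -
  note x = tight_homD[OF assms]
  have h: "cartesian X (hom_cell X x (tid X B))"
    "hom_cell X x (tid X B) \<in> cells X x [hom X x (tid X B)] (lid X B) (tid X B)"
    using hom_cell[of x "tid X B" B] x by simp_all
  have "ccomp X (lid_cell X B) x [] \<in> cells X (x \<cdot> tid X D) [] (lid X B) (tid X B \<cdot> x)"
    using ccomp0[OF lid_cell(4)[OF x(5)] x(1)] x by simp
  from cart_factorD[OF h this] x that show ?thesis by simp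
qed

text \<open>Here \<open>\<zeta>\<close> stands for a cocone for \<open>h\<close> with apex
  \<open>k\<close>. At \<open>x = tid X B\<close> this is the colimit condition; \<open>x\<close> is
  a parameter because restricting along \<open>j\<close> and \<open>r\<close> produces 2-cells with
  right tight-cell \<open>r\<close>.\<close>

definition lid_lift :: "'o \<Rightarrow> 'l \<Rightarrow> 't \<Rightarrow> 't \<Rightarrow> 'c \<Rightarrow> 't \<Rightarrow> bool" where
  "lid_lift B p h k \<zeta> x \<longleftrightarrow> (\<forall>rs. bij_betw (\<lambda>\<psi>. ccomp X (lid_mult X B) h [\<zeta>, \<psi>])
     (cells X k rs (lid X B) x) (cells X h (p # rs) (lid X B) x))"

text \<open>2-cells with right \<open>x\<close> embed, compatibly with pasting, into those with right \<open>1\<close> by appending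
  \<open>B(x,1)\<close> to the domain, and \<open>\<eta>\<close> retracts this embedding.\<close>

lemma lid_lift_tight:
  assumes \<zeta>: "\<zeta> \<in> cells X h [p] (lid X B) k" and x: "x \<in> tight_hom X D B"
    and lift: "lid_lift B p h k \<zeta> (tid X B)"
  shows "lid_lift B p h k \<zeta> x"
proof -
  note z = cellsD[OF \<zeta>] and x' = tight_homD[OF x]
  note mc = lid_mult_cells[OF x'(5)]
  let ?m = "lid_mult X B" and ?H = "hom X x (tid X B)" and ?K = "hom_cell X x (tid X B)"
  have K: "?K \<in> cells X x [?H] (lid X B) (tid X B)" and H: "?H \<in> Loose X" "ltgt X ?H = D"
    using hom_cell[of x "tid X B" B] x' by simp_all
  obtain \<eta> where \<eta>: "\<eta> \<in> cells X (tid X D) [] ?H x"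
    "ccomp X ?K (tid X D) [\<eta>] = ccomp X (lid_cell X B) x []"
    using companion_unit[OF x] by blast
  have pz: "ltgt X p = tdom X h" "lsrc X p = tdom X k" "p \<in> Loose X" "tdom X k \<in> Obj X"
    using z tight_dom by auto
  \<comment> \<open>By the companion identity, \<open>\<eta>\<close> turns the appended
    \<open>?K\<close> into the identity of \<open>x\<close>, which the right unit law
    removes.\<close>
  have retract: "ccomp X (ccomp X ?m f [\<psi>, ?K]) (tid X (tdom X f)) (map (cid X) ps @ [\<eta>]) = \<psi>"
    if \<psi>: "\<psi> \<in> cells X f ps (lid X B) x" for f ps \<psi>
  proof -
    note c = cellsD[OF \<psi>]
    have r: "cpath_right X (tid X (tdom X f)) (map (cid X) ps) = tid X D"
      using chain_cids(2)[OF c(8)] x' by simp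
    have "ccomp X (ccomp X ?m f [\<psi>, ?K]) (tid X (tdom X f)) (map (cid X) ps @ [\<eta>]) =
      ccomp X ?m (f \<cdot> tid X (tdom X f)) [ccomp X \<psi> (tid X (tdom X f)) (map (cid X) ps),
        ccomp X ?K (cpath_right X (tid X (tdom X f)) (map (cid X) ps)) [\<eta>]]"
      using composable1[OF K \<eta>(1)]
      by (intro ccomp_assoc2 mc(2)[OF \<psi> K] composable_cids[OF \<psi> refl]) (simp add: r)
    then show ?thesis
      using r \<eta>(2) ccomp_cid_cells(2)[OF \<psi> refl] c lid_mult_unit_right[OF \<psi> x'(5)] by simp
  qed
  \<comment> \<open>\<open>\<eta>\<close> enters at the right end and \<open>\<zeta>\<close> at the
    left, so the two operations commute.\<close>
  have shift: "ccomp X (ccomp X ?m h [\<zeta>, \<xi>]) (tid X (tdom X h)) (map (cid X) (p # rs) @ [\<eta>]) =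
      ccomp X ?m h [\<zeta>, ccomp X \<xi> (tid X (tdom X k)) (map (cid X) rs @ [\<eta>])]"
    and shift_cells: "ccomp X \<xi> (tid X (tdom X k)) (map (cid X) rs @ [\<eta>]) \<in> cells X k rs (lid X B) x"
    if \<xi>: "\<xi> \<in> cells X k (rs @ [?H]) (lid X B) (tid X B)" for \<xi> rs
  proof -
    have cp: "composable X \<zeta> (tid X (tdom X h)) [cid X p]"
      using composable_cids[OF \<zeta> refl] by simp
    have r: "cpath_right X (tid X (tdom X h)) [cid X p] = tid X (tdom X k)"
      using chain_cids(2)[OF z(8)] by simp
    note ins = composable_insert_right[OF \<xi>, of \<eta> "[]" x]
    have "ccomp X (ccomp X ?m h [\<zeta>, \<xi>]) (tid X (tdom X h)) ([cid X p] @ (map (cid X) rs @ [\<eta>])) =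
      ccomp X ?m (h \<cdot> tid X (tdom X h)) [ccomp X \<zeta> (tid X (tdom X h)) [cid X p],
       ccomp X \<xi> (cpath_right X (tid X (tdom X h)) [cid X p]) (map (cid X) rs @ [\<eta>])]"
      using ins(1) \<eta>(1) H r by (intro ccomp_assoc2 mc(2)[OF \<zeta> \<xi>] cp) simp
    then show "ccomp X (ccomp X ?m h [\<zeta>, \<xi>]) (tid X (tdom X h)) (map (cid X) (p # rs) @ [\<eta>]) =
      ccomp X ?m h [\<zeta>, ccomp X \<xi> (tid X (tdom X k)) (map (cid X) rs @ [\<eta>])]"
      using r z ccomp_cid_cells(2)[OF \<zeta> refl] by simp
    show "ccomp X \<xi> (tid X (tdom X k)) (map (cid X) rs @ [\<eta>]) \<in> cells X k rs (lid X B) x"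
      using ins(2) \<eta>(1) H x' by simp
  qed
  have "bij_betw (\<lambda>\<psi>. ccomp X ?m h [\<zeta>, \<psi>]) (cells X k rs (lid X B) x) (cells X h (p # rs) (lid X B) x)"
    for rs
  proof (rule bij_betw_iff_ex1[THEN iffD2, OF _ ballI])
    show "ccomp X ?m h [\<zeta>, \<psi>] \<in> cells X h (p # rs) (lid X B) x"
      if "\<psi> \<in> cells X k rs (lid X B) x" for \<psi>
      using mc(1)[OF \<zeta> that] by simp
    fix \<chi> assume \<chi>: "\<chi> \<in> cells X h (p # rs) (lid X B) x"
    have bij: "bij_betw (\<lambda>\<psi>. ccomp X ?m h [\<zeta>, \<psi>]) (cells X k (rs @ [?H]) (lid X B) (tid X B))
       (cells X h (p # rs @ [?H]) (lid X B) (tid X B))"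
      using lift by (simp add: lid_lift_def)
    have "ccomp X ?m h [\<chi>, ?K] \<in> cells X h (p # rs @ [?H]) (lid X B) (tid X B)"
      using mc(1)[OF \<chi> K] by simp
    \<comment> \<open>The lift is found for the longer domain \<open>rs\<close> followed by
      \<open>?H\<close>, where the right tight-cell is an identity, and then retracted along
      \<open>\<eta>\<close>.\<close>
    then obtain \<xi> where \<xi>: "\<xi> \<in> cells X k (rs @ [?H]) (lid X B) (tid X B)"
      "ccomp X ?m h [\<chi>, ?K] = ccomp X ?m h [\<zeta>, \<xi>]"
      using bij_betw_imp_surj_on[OF bij] by blast
    define \<psi> where "\<psi> = ccomp X \<xi> (tid X (tdom X k)) (map (cid X) rs @ [\<eta>])"
    show "\<exists>!\<psi>. \<psi> \<in> cells X k rs (lid X B) x \<and> ccomp X ?m h [\<zeta>, \<psi>] = \<chi>"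
    proof (rule ex1I[of _ \<psi>])
      show "\<psi> \<in> cells X k rs (lid X B) x \<and> ccomp X ?m h [\<zeta>, \<psi>] = \<chi>"
        using shift_cells[OF \<xi>(1)] shift[OF \<xi>(1)] retract[OF \<chi>] \<xi>(2) by (simp add: \<psi>_def)
    next
      fix \<psi>' assume *: "\<psi>' \<in> cells X k rs (lid X B) x \<and> ccomp X ?m h [\<zeta>, \<psi>'] = \<chi>"
      then have c: "\<psi>' \<in> cells X k rs (lid X B) x" by simp
      \<comment> \<open>By associativity, extending any solution \<open>\<psi>'\<close> by
        \<open>?K\<close> solves the extended problem, so it equals \<open>\<xi>\<close>.\<close>
      have "ccomp X ?m h [\<zeta>, ccomp X ?m k [\<psi>', ?K]] = ccomp X ?m h [\<zeta>, \<xi>]"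
        using lid_mult_assoc[OF x'(5) \<zeta> c K] * \<xi>(2) by simp
      then have "ccomp X ?m k [\<psi>', ?K] = \<xi>"
        using inj_onD[OF bij_betw_imp_inj_on[OF bij]] mc(1)[OF c K] \<xi>(1) by simp
      then show "\<psi>' = \<psi>"
        using retract[OF c] by (simp add: \<psi>_def)
    qed
  qed
  then show ?thesis by (simp add: lid_lift_def)
qed

section \<open>Colimits and their preservation as lifting conditions\<close>

text \<open>Postcomposition with the cartesian 2-cells of B(k,1) and B(h,1) identifies both sides of
  the right-lift bijection with sets of 2-cells into B(1,1), and carries the lifting operation to
  pasting with the transpose of \<open>lam\<close>.\<close>

lemma colimit_iff_lid_lift:
  assumes p: "p \<in> loose_hom X Y Z" and h: "h \<in> tight_hom X Z B" and k: "k \<in> tight_hom X Y B"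
    and lam: "lam \<in> gcells X [p] (hom X h k)"
  shows "colimit X p h k lam \<longleftrightarrow>
    lid_lift B p h k (ccomp X (hom_cell X h k) (tid X Z) [lam]) (tid X B)"
proof -
  let ?i = "tid X B" and ?m = "lid_mult X B"
  note h' = tight_homD[OF h] and k' = tight_homD[OF k]
  have p': "p \<in> Loose X" "lsrc X p = Y" "ltgt X p = Z"
    using p by (auto simp: loose_hom_def)
  note hk = hom_cell[OF h'(1) k'(1) h'(3) k'(3)]
  have hi: "cartesian X (hom_cell X h ?i)" "hom_cell X h ?i \<in> cells X h [hom X h ?i] (lid X B) ?i"
    "lsrc X (hom X h ?i) = B" "ltgt X (hom X h ?i) = Z"
    using hom_cell[of h ?i B] h' by simp_all
  have ki: "cartesian X (hom_cell X k ?i)" "hom_cell X k ?i \<in> cells X k [hom X k ?i] (lid X B) ?i"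
    "hom X k ?i \<in> Loose X" "lsrc X (hom X k ?i) = B" "ltgt X (hom X k ?i) = Y"
    using hom_cell[of k ?i B] k' by simp_all
  have lam': "lam \<in> cells X (tid X Z) [p] (hom X h k) (tid X Y)"
    using lam hk h' k' by (simp add: gcells_def)
  let ?cr = "cup_restr X k h ?i"
  have cr: "?cr \<in> cells X (tid X Z) [hom X h k, hom X k ?i] (hom X h ?i) ?i"
    "ccomp X (hom_cell X h ?i) (tid X Z) [?cr] = ccomp X ?m h [hom_cell X h k, hom_cell X k ?i]"
    using cup_restr[of k h ?i B] h' k' by simp_all
  have e: "cid X (hom X k ?i) \<in> cells X (tid X Y) [hom X k ?i] (hom X k ?i) ?i"
    using cid_cells[OF ki(3)] ki by simp
  let ?\<omega> = "ccomp X ?cr (tid X Z) [lam, cid X (hom X k ?i)]"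
  let ?\<zeta> = "ccomp X (hom_cell X h k) (tid X Z) [lam]"
  have \<omega>: "?\<omega> \<in> cells X (tid X Z) [p, hom X k ?i] (hom X h ?i) ?i"
    using ccomp2[OF cr(1) lam' e] h' by simp
  have cp: "cid X p \<in> cells X (tid X Z) [p] p (tid X Y)"
    using cid_cells[OF p'(1)] p' by simp
  have \<omega>t: "ccomp X ?\<omega> (tid X Z) [cid X p, \<psi>] \<in> cells X (tid X Z) (p # rs) (hom X h ?i) ?i"
    if "\<psi> \<in> cells X (tid X Y) rs (hom X k ?i) ?i" for rs \<psi>
    using ccomp2[OF \<omega> cp that] h' by simp
  \<comment> \<open>\<open>?\<omega>\<close> is first unfolded to \<open>?cr\<close> pasted with
    \<open>lam\<close> and \<open>\<psi>\<close>; the equation for \<open>cup_restr\<close> then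
    turns this into a multiplication.\<close>
  have sq: "ccomp X (hom_cell X h ?i) (tid X Z) [ccomp X ?\<omega> (tid X Z) [cid X p, \<psi>]] =
      ccomp X ?m h [?\<zeta>, ccomp X (hom_cell X k ?i) (tid X Y) [\<psi>]]"
    if \<psi>: "\<psi> \<in> cells X (tid X Y) rs (hom X k ?i) ?i" for rs \<psi>
  proof -
    have "ccomp X ?\<omega> (tid X Z) [cid X p, \<psi>] =
      ccomp X ?cr (tid X Z \<cdot> tid X Z) [ccomp X lam (tid X Z) [cid X p],
        ccomp X (cid X (hom X k ?i)) (tid X Y) [\<psi>]]"
      by (rule ccomp_assoc22[OF cr(1) lam' e cp \<psi>])
    also have "\<dots> = ccomp X ?cr (tid X Z) [lam, \<psi>]"
      using ccomp_cid_cells(2)[OF lam', of Z] ccomp_cid_cells(1)[OF \<psi>] h' by simp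
    finally have "ccomp X (hom_cell X h ?i) (tid X Z) [ccomp X ?\<omega> (tid X Z) [cid X p, \<psi>]] =
      ccomp X (hom_cell X h ?i) (tid X Z \<cdot> tid X Z) [ccomp X ?cr (tid X Z) [lam, \<psi>]]"
      using h' by simp
    also have "\<dots> = ccomp X (ccomp X (hom_cell X h ?i) (tid X Z) [?cr]) (tid X Z) [lam, \<psi>]"
      by (rule ccomp_assoc12[OF hi(2) cr(1) lam' \<psi>, symmetric])
    also have "\<dots> = ccomp X ?m (h \<cdot> tid X Z) [?\<zeta>, ccomp X (hom_cell X k ?i) (tid X Y) [\<psi>]]"
      unfolding cr(2) using lid_mult(1)[OF h'(5)] hk(2) ki(2) lam' \<psi>
        ccomp_assoc2[OF lid_mult_cells(2)[OF h'(5) hk(2) ki(2)] composable1[OF hk(2) lam'], of "[\<psi>]"]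
        composable1[OF ki(2) \<psi>] cellsD(5)[OF lam'] by simp
    finally show ?thesis using h' by simp
  qed
  have bij: "bij_betw (\<lambda>\<psi>. ccomp X ?\<omega> (tid X Z) [cid X p, \<psi>])
      (cells X (tid X Y) rs (hom X k ?i) ?i) (cells X (tid X Z) (p # rs) (hom X h ?i) ?i) \<longleftrightarrow>
    bij_betw (\<lambda>\<psi>. ccomp X ?m h [?\<zeta>, \<psi>]) (cells X k rs (lid X B) ?i) (cells X h (p # rs) (lid X B) ?i)"
    for rs
  proof (rule bij_betw_square)
    show "bij_betw (\<lambda>\<psi>. ccomp X (hom_cell X k ?i) (tid X Y) [\<psi>])
      (cells X (tid X Y) rs (hom X k ?i) ?i) (cells X k rs (lid X B) ?i)"
      using cartesian_bij[OF ki(1,2), of "tid X Y" ?i rs] k' by simp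
    show "bij_betw (\<lambda>\<psi>. ccomp X (hom_cell X h ?i) (tid X Z) [\<psi>])
      (cells X (tid X Z) (p # rs) (hom X h ?i) ?i) (cells X h (p # rs) (lid X B) ?i)"
      using cartesian_bij[OF hi(1,2), of "tid X Z" ?i "p # rs"] h' by simp
  qed (fact \<omega>t, fact sq)
  have "cocone X p h k lam"
    using p h k lam by (auto simp: cocone_def)
  then have "colimit X p h k lam \<longleftrightarrow> (\<forall>rs. \<forall>\<phi>\<in>cells X (tid X Z) (p # rs) (hom X h ?i) ?i.
      \<exists>!\<psi>. \<psi> \<in> cells X (tid X Y) rs (hom X k ?i) ?i \<and> ccomp X ?\<omega> (tid X Z) [cid X p, \<psi>] = \<phi>)"
    using h' p' \<omega> by (simp add: colimit_def right_lift_def gcells_def hi(3,4) ki(4,5) Let_def)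
  also have "\<dots> \<longleftrightarrow> (\<forall>rs. bij_betw (\<lambda>\<psi>. ccomp X ?\<omega> (tid X Z) [cid X p, \<psi>])
      (cells X (tid X Y) rs (hom X k ?i) ?i) (cells X (tid X Z) (p # rs) (hom X h ?i) ?i))"
    by (intro all_cong1 bij_betw_iff_ex1[symmetric] \<omega>t)
  finally show ?thesis
    by (simp add: bij lid_lift_def)
qed

text \<open>By the equation for \<open>cap_restr\<close>, the image cocone transposes to the
  transpose of \<open>lam\<close> whiskered with \<open>action g\<close>; the colimit criterion is
  applied to it.\<close>

lemma preserves_iff_lid_lift:
  assumes p: "p \<in> loose_hom X Y Z" and f: "f \<in> tight_hom X Z A" and c: "c \<in> tight_hom X Y A"
    and lam: "lam \<in> gcells X [p] (hom X f c)" and g: "g \<in> tight_hom X A B"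
  shows "preserves_colimit X g p f c lam \<longleftrightarrow> lid_lift B p (g \<cdot> f) (g \<cdot> c)
    (ccomp X (action g) f [ccomp X (hom_cell X f c) (tid X Z) [lam]]) (tid X B)"
proof -
  note f' = tight_homD[OF f] and c' = tight_homD[OF c] and g' = tight_homD[OF g]
  have p': "p \<in> Loose X" "lsrc X p = Y" "ltgt X p = Z"
    using p by (auto simp: loose_hom_def)
  note fc = hom_cell[OF f'(1) c'(1) f'(3) c'(3)]
  have lam': "lam \<in> cells X (tid X Z) [p] (hom X f c) (tid X Y)"
    using lam fc f' c' by (simp add: gcells_def)
  note gf = tcomp_hom[OF f g] and gc = tcomp_hom[OF c g]
  note cr = cap_restr[OF g f c]
  let ?\<mu> = "ccomp X (cap_restr X g f c) (tid X Z) [lam]"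
  have gh: "hom_cell X (g \<cdot> f) (g \<cdot> c) \<in> cells X (g \<cdot> f) [hom X (g \<cdot> f) (g \<cdot> c)] (lid X B) (g \<cdot> c)"
    "ltgt X (hom X (g \<cdot> f) (g \<cdot> c)) = Z" "lsrc X (hom X (g \<cdot> f) (g \<cdot> c)) = Y"
    using hom_cell[of "g \<cdot> f" "g \<cdot> c" B] f' c' g' by simp_all
  have "?\<mu> \<in> gcells X [p] (hom X (g \<cdot> f) (g \<cdot> c))"
    using ccomp1[OF cr(1) lam'] f' c' gh by (simp add: gcells_def)
  from colimit_iff_lid_lift[OF p gf gc this]
  have "preserves_colimit X g p f c lam \<longleftrightarrow> lid_lift B p (g \<cdot> f) (g \<cdot> c)
    (ccomp X (hom_cell X (g \<cdot> f) (g \<cdot> c)) (tid X Z) [?\<mu>]) (tid X B)"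
    by (simp add: preserves_colimit_def p')
  moreover have "ccomp X (hom_cell X (g \<cdot> f) (g \<cdot> c)) (tid X Z) [?\<mu>] =
      ccomp X (action g) f [ccomp X (hom_cell X f c) (tid X Z) [lam]]"
    using ccomp_assoc11[OF gh(1) cr(1) lam'] ccomp_assoc11[OF action(1)[OF g] fc(2) lam'] cr(2) f'
    by simp
  ultimately show ?thesis by simp
qed

section \<open>Lifting conditions expressed by the action of the loose-identity\<close>

text \<open>This is the left unitor of \<open>q\<close>: inserting the unit of the loose-identity
  makes it the identity. It is built from \<open>q\<close> alone, so it is common to all
  presentations of \<open>q\<close> as a restriction.\<close>

definition lid_act :: "'l \<Rightarrow> 'c" where
  "lid_act q = opcart_factor X (lid_cell X (ltgt X q)) [] [q] (cid X q)"

lemma lid_act: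
  assumes "q \<in> Loose X" "ltgt X q = A" "lsrc X q = D"
  shows "lid_act q \<in> cells X (tid X A) [lid X A, q] q (tid X D)"
    "ccomp X (lid_act q) (tid X A) [lid_cell X A, cid X q] = cid X q"
proof -
  have ob: "A \<in> Obj X" "D \<in> Obj X"
    using assms loose_tgt loose_src by auto
  show "lid_act q \<in> cells X (tid X A) [lid X A, q] q (tid X D)"
    "ccomp X (lid_act q) (tid X A) [lid_cell X A, cid X q] = cid X q"
    using opcart_factorD[OF lid_cell(1)[OF ob(1)], of "cid X q" "tid X A" "[]" "[q]" q "tid X D"]
      cid_cells[OF assms(1)] lid_cell[OF ob(1)] assms ob by (simp_all add: lid_act_def)
qed

text \<open>Inserting the unit of A(1,1) turns both sides into \<open>\<alpha>\<close>: the left by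
  the property of \<open>lid_act\<close>, the right because \<open>action g\<close> sends the unit
  to the identity of \<open>g\<close>, which the left unit law absorbs.\<close>

lemma cell_lid_act:
  assumes \<alpha>: "\<alpha> \<in> cells X g [q] (lid X B) x" and g: "g \<in> tight_hom X A B"
  shows "ccomp X \<alpha> (tid X A) [lid_act q] = ccomp X (lid_mult X B) g [action g, \<alpha>]"
proof -
  note g' = tight_homD[OF g] and a = cellsD[OF \<alpha>]
  let ?D = "tdom X x"
  have q: "q \<in> Loose X" "ltgt X q = A" "lsrc X q = ?D" and D: "?D \<in> Obj X"
    using a g' tight_dom by auto
  note la = lid_act[OF q]
  have e: "cid X q \<in> cells X (tid X A) [q] q (tid X ?D)"
    using cid_cells[OF q(1)] q by simp
  note u = lid_cell[OF g'(4)] and ac = action[OF g]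
  have 1: "ccomp X (ccomp X \<alpha> (tid X A) [lid_act q]) (tid X A) [lid_cell X A, cid X q] = \<alpha>"
    using ccomp_assoc12[OF \<alpha> la(1) u(4) e] la(2) ccomp_cid_cells(2)[OF \<alpha>, of A] g' by simp
  have "ccomp X (ccomp X (lid_mult X B) g [action g, \<alpha>]) (tid X A) ([lid_cell X A] @ [cid X q]) =
    ccomp X (lid_mult X B) (g \<cdot> tid X A) [ccomp X (action g) (tid X A) [lid_cell X A],
      ccomp X \<alpha> (cpath_right X (tid X A) [lid_cell X A]) [cid X q]]"
    using cellsD(5)[OF u(4)] composable1[OF \<alpha> e]
    by (intro ccomp_assoc2 lid_mult_cells(2)[OF g'(5) ac(1) \<alpha>] composable1[OF ac(1) u(4)]) simp
  then have 2: "ccomp X (ccomp X (lid_mult X B) g [action g, \<alpha>]) (tid X A) [lid_cell X A, cid X q] = \<alpha>"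
    using ac(2) cellsD(5)[OF u(4)] ccomp_cid_cells(2)[OF \<alpha>, of A] g'
      lid_mult_unit_left[OF \<alpha> g'(5)] by simp
  show ?thesis
    by (rule lid_eqI[OF g'(4), of _ g "[]" "[q]" "lid X B" x])
      (use 1 2 ccomp1[OF \<alpha> la(1)] lid_mult_cells(1)[OF g'(5) ac(1) \<alpha>] g' a in simp_all)
qed

text \<open>Since \<open>\<alpha>\<close> is cartesian, postcomposing with it is bijective on both
  sides, and \<open>cell_lid_act\<close> makes the square commute. The resulting condition mentions
  neither \<open>g\<close> nor \<open>B\<close>, and \<open>x\<close> only through its
  domain.\<close>

lemma lid_lift_iff_lid_act:
  assumes \<alpha>: "cartesian X \<alpha>" "\<alpha> \<in> cells X g [q] (lid X B) x"
    and \<zeta>: "\<zeta> \<in> cells X f [p] (lid X A) c" and g: "g \<in> tight_hom X A B"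
  shows "lid_lift B p (g \<cdot> f) (g \<cdot> c) (ccomp X (action g) f [\<zeta>]) x \<longleftrightarrow>
    (\<forall>rs. bij_betw (\<lambda>\<psi>. ccomp X (lid_act q) f [\<zeta>, \<psi>])
      (cells X c rs q (tid X (tdom X x))) (cells X f (p # rs) q (tid X (tdom X x))))"
proof -
  note g' = tight_homD[OF g] and a = cellsD[OF \<alpha>(2)] and z = cellsD[OF \<zeta>]
  let ?D = "tdom X x"
  have q: "q \<in> Loose X" "ltgt X q = A" "lsrc X q = ?D" and D: "?D \<in> Obj X"
    using a g' tight_dom by auto
  have fc: "tcod X f = A" "tcod X c = A"
    using z lid_cell(6,7)[OF g'(4)] by simp_all
  note la = lid_act[OF q] and ac = action[OF g]
  have lat: "ccomp X (lid_act q) f [\<zeta>, \<psi>] \<in> cells X f (p # rs) q (tid X ?D)"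
    if "\<psi> \<in> cells X c rs q (tid X ?D)" for \<psi> rs
    using ccomp2[OF la(1) \<zeta> that] fc z D by simp
  have sq: "ccomp X \<alpha> f [ccomp X (lid_act q) f [\<zeta>, \<psi>]] =
      ccomp X (lid_mult X B) (g \<cdot> f) [ccomp X (action g) f [\<zeta>], ccomp X \<alpha> c [\<psi>]]"
    if \<psi>: "\<psi> \<in> cells X c rs q (tid X ?D)" for \<psi> rs
  proof -
    have "ccomp X \<alpha> f [ccomp X (lid_act q) f [\<zeta>, \<psi>]] =
      ccomp X (ccomp X \<alpha> (tid X A) [lid_act q]) f [\<zeta>, \<psi>]"
      using ccomp_assoc12[OF \<alpha>(2) la(1) \<zeta> \<psi>] fc z by simp
    also have "\<dots> = ccomp X (ccomp X (lid_mult X B) g [action g, \<alpha>]) f ([\<zeta>] @ [\<psi>])"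
      by (simp add: cell_lid_act[OF \<alpha>(2) g])
    also have "\<dots> = ccomp X (lid_mult X B) (g \<cdot> f) [ccomp X (action g) f [\<zeta>],
        ccomp X \<alpha> (cpath_right X f [\<zeta>]) [\<psi>]]"
      using composable1[OF \<alpha>(2) \<psi>] z(5)
      by (intro ccomp_assoc2 lid_mult_cells(2)[OF g'(5) ac(1) \<alpha>(2)] composable1[OF ac(1) \<zeta>]) simp
    finally show ?thesis using z(5) by simp
  qed
  have "bij_betw (\<lambda>\<psi>. ccomp X (lid_act q) f [\<zeta>, \<psi>])
      (cells X c rs q (tid X ?D)) (cells X f (p # rs) q (tid X ?D)) \<longleftrightarrow>
    bij_betw (\<lambda>\<psi>. ccomp X (lid_mult X B) (g \<cdot> f) [ccomp X (action g) f [\<zeta>], \<psi>])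
      (cells X (g \<cdot> c) rs (lid X B) x) (cells X (g \<cdot> f) (p # rs) (lid X B) x)" for rs
  proof (rule bij_betw_square)
    show "bij_betw (\<lambda>\<psi>. ccomp X \<alpha> c [\<psi>]) (cells X c rs q (tid X ?D)) (cells X (g \<cdot> c) rs (lid X B) x)"
      using cartesian_bij[OF \<alpha>, of c "tid X ?D" rs] fc z g' a D by simp
    show "bij_betw (\<lambda>\<psi>. ccomp X \<alpha> f [\<psi>])
      (cells X f (p # rs) q (tid X ?D)) (cells X (g \<cdot> f) (p # rs) (lid X B) x)"
      using cartesian_bij[OF \<alpha>, of f "tid X ?D" "p # rs"] fc z g' a D by simp
  qed (fact lat, fact sq)
  then show ?thesis by (simp add: lid_lift_def)
qed

section \<open>Transfer along the relative adjunction\<close>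

lemma left_relative_adjoint_preserves_colimit:
  assumes j: "j \<in> tight_hom X A E" and l: "l \<in> tight_hom X A C"
    and adj: "left_relative_adjoint X j l"
    and p: "p \<in> loose_hom X Y Z" and f: "f \<in> tight_hom X Z A" and c: "c \<in> tight_hom X Y A"
    and lam: "lam \<in> gcells X [p] (hom X f c)"
    and pres: "preserves_colimit X j p f c lam"
  shows "preserves_colimit X l p f c lam"
proof -
  note j' = tight_homD[OF j] and l' = tight_homD[OF l] and f' = tight_homD[OF f] and c' = tight_homD[OF c]
  \<comment> \<open>The boundaries of \<open>j\<close> and \<open>l\<close> force the objects hidden
    in \<open>relative_adjunction\<close> to be \<open>A\<close>, \<open>C\<close> and
    \<open>E\<close>.\<close>
  from adj obtain r \<phi> where r: "r \<in> tight_hom X C E"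
    and \<phi>: "loose_iso X \<phi> (hom X l (tid X C)) (hom X j r)"
    using j' l' by (auto simp: left_relative_adjoint_def relative_adjunction_def tight_hom_def)
  note r' = tight_homD[OF r]
  let ?q = "hom X l (tid X C)" and ?\<zeta> = "ccomp X (hom_cell X f c) (tid X Z) [lam]"
  note fc = hom_cell[OF f'(1) c'(1) f'(3) c'(3)]
  have \<zeta>: "?\<zeta> \<in> cells X f [p] (lid X A) c"
    using ccomp1[OF fc(2), of lam "tid X Z" "[p]" "tid X Y"] lam fc f' c' by (simp add: gcells_def)
  have l1: "cartesian X (hom_cell X l (tid X C))"
    "hom_cell X l (tid X C) \<in> cells X l [?q] (lid X C) (tid X C)"
    using hom_cell[of l "tid X C" C] l' by simp_all
  note jr = hom_cell[OF j'(1) r'(1) j'(3) r'(3)]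
  \<comment> \<open>\<open>?\<alpha>\<close> presents \<open>?q\<close> as a restriction of E(1,1)
    along \<open>j\<close> and \<open>r\<close>.\<close>
  let ?\<alpha> = "ccomp X (hom_cell X j r) (tid X (ltgt X (hom X j r))) [\<phi>]"
  note \<alpha> = cartesian_iso[OF jr(1,2) \<phi>]
  have "lid_lift E p (j \<cdot> f) (j \<cdot> c) (ccomp X (action j) f [?\<zeta>]) (tid X E)"
    using preserves_iff_lid_lift[OF p f c lam j] pres by simp
  \<comment> \<open>The right tight-cell of \<open>?\<alpha>\<close> is \<open>r\<close>, so the
    condition is first extended from \<open>tid X E\<close> to \<open>r\<close>.\<close>
  then have "lid_lift E p (j \<cdot> f) (j \<cdot> c) (ccomp X (action j) f [?\<zeta>]) r"
    by (rule lid_lift_tight[OF ccomp1[OF action(1)[OF j] \<zeta>] r])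
  \<comment> \<open>\<open>?\<alpha>\<close> and \<open>hom_cell X l (tid X C)\<close> are cartesian
    with the same domain \<open>?q\<close>, and \<open>r\<close> and \<open>tid X C\<close> both
    start at \<open>C\<close>; so both conditions are equivalent to a single one about
    \<open>lid_act ?q\<close>.\<close>
  then have "lid_lift C p (l \<cdot> f) (l \<cdot> c) (ccomp X (action l) f [?\<zeta>]) (tid X C)"
    using lid_lift_iff_lid_act[OF \<alpha> \<zeta> j] lid_lift_iff_lid_act[OF l1 \<zeta> l] r' l' by simp
  then show ?thesis
    using preserves_iff_lid_lift[OF p f c lam l] by simp
qed

end

theorem proposition5p11:
  fixes X :: "('o, 't, 'l, 'c) vdc"
    and A E C Y Z :: 'o and j l f c :: 't and p :: 'l and lam :: 'c
  assumes "virtual_equipment X"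
    and "j \<in> tight_hom X A E"
    and "l \<in> tight_hom X A C"
    and "left_relative_adjoint X j l"
    and "p \<in> loose_hom X Y Z"
    and "f \<in> tight_hom X Z A"
    and "c \<in> tight_hom X Y A"
    and "colimit X p f c lam"
    and "preserves_colimit X j p f c lam"
  shows "preserves_colimit X l p f c lam"
proof -
  interpret virtual_equipment X by fact
  have "lam \<in> gcells X [p] (hom X f c)"
    using assms(8) by (auto simp: colimit_def cocone_def)
  then show ?thesis
    using left_relative_adjoint_preserves_colimit assms(2-7,9) by blast
qed

end
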